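(* Let $0\le k\le n$ and let $\lambda\vdash k$. The dimension over $\mathbb C$ of the indecomposable projective $\mathbb C\mathcal{PT}_n$-module $\mathbb C\widetilde{\mathcal L}_E(\mathrm{id}_k)\bigotimes_{\mathbb CS_k}S^{\lambda}$ is given by the formula $$\sum_{l=1}^{k}\ \sum_{\substack{\mu\vDash k\\ |\mu|=l}}\binom{n}{l}K_{\lambda\mu}.$$
   Context: $\mathcal{PT}_n$ is the monoid of all partial functions on $\{1,\dots,n\}$, with functions composed from right to left. $\mathrm{id}_A$ is the partial identity on $A\subseteq\{1,\dots,n\}$; $\mathrm{id}_k=\mathrm{id}_{\{1,\dots,k\}}$; $E=\{\mathrm{id}_A\mid A\subseteq\{1,\dots,n\}\}$. The relation $\widetilde{\mathcal L}_E$ is: $a\,\widetilde{\mathcal L}_E\,b$ iff for all $e\in E$ ($ae=a\Leftrightarrow be=b$), i.e. $\operatorname{dom}(a)=\operatorname{dom}(b)$; so $\widetilde{\mathcal L}_E(\mathrm{id}_k)$, the class of $\mathrm{id}_k$, is the set of $f\in\mathcal{PT}_n$ with $\operatorname{dom}(f)=\{1,\dots,k\}$. $\mathbb C\widetilde{\mathcal L}_E(\mathrm{id}_k)$ is the vector space with this basis; it is a $\mathbb C\mathcal{PT}_n$-$\mathbb CS_k$-bimodule, where $s\in\mathcal{PT}_n$ acts on a basis element $x$ by $s\cdot x=sx$ if $sx\in\widetilde{\mathcal L}_E(\mathrm{id}_k)$ and $0$ otherwise, and the symmetric group $S_k$ acts by right multiplication. $\lambda\vdash k$ means $\lambda$ is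 a partition of $k$. $\mu\vDash k$ means $\mu=[\mu_1,\dots,\mu_l]$ is a composition of $k$ (ordered tuple of positive integers with sum $k$), and $|\mu|=l$ denotes its number of parts. $S^{\lambda}$ is the Specht module of $\mathbb CS_k$ indexed by the partition $\lambda$ (with the convention that $S^{[k]}$ is the trivial module). The Kostka number $K_{\lambda\mu}$ is the number of semistandard Young tableaux (columns strictly increasing, rows non-decreasing) of shape $\lambda$ and content $\mu$ (each $i$ appears $\mu_i$ times).
   Formalization: The sum starts at l = 0 instead of l = 1: for k = 0 the printed formula is an empty sum, 0, while the module has dimension 1; the l = 0 term (the empty composition) supplies this 1, and for k ≥ 1 the formula is unchanged. *)

theory Defs
  imports
    "HOL-Algebra.Sym_Groups"
    "HOL-Algebra.AbelCoset"
    "HOL-Library.Poly_Mapping"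
    "Jordan_Normal_Form.VS_Connect"
begin

section \<open>Free complex vector spaces, linear extension, quotients\<close>

abbreviation cscale :: "complex \<Rightarrow> ('x \<Rightarrow>\<^sub>0 complex) \<Rightarrow> ('x \<Rightarrow>\<^sub>0 complex)" where
  "cscale c \<equiv> Poly_Mapping.map ((*) c)"

abbreviation basis_vec :: "'x \<Rightarrow> ('x \<Rightarrow>\<^sub>0 complex)" where
  "basis_vec x \<equiv> Poly_Mapping.single x 1"

text \<open>The ring fields \<^term>\<open>mult\<close> and \<^term>\<open>one\<close> are only there because the library's
  module record extends the ring record; no notion of modules or vector spaces looks at them.\<close>

definition free_space :: "'x set \<Rightarrow> (complex, 'x \<Rightarrow>\<^sub>0 complex) module" where
  "free_space X =
    \<lparr> carrier = {v. Poly_Mapping.keys v \<subseteq> X}, mult = undefined, one = undefined,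
      zero = 0, add = (+), smult = cscale \<rparr>"

definition lin_ext :: "('x \<Rightarrow> ('y \<Rightarrow>\<^sub>0 complex)) \<Rightarrow> ('x \<Rightarrow>\<^sub>0 complex) \<Rightarrow> ('y \<Rightarrow>\<^sub>0 complex)" where
  "lin_ext f v = (\<Sum>x\<in>Poly_Mapping.keys v. cscale (Poly_Mapping.lookup v x) (f x))"

text \<open>A complex vector space together with an operation of the elements of an algebra.\<close>

record ('a, 'v) alg_module = "(complex, 'v) module" +
  act :: "'a \<Rightarrow> 'v \<Rightarrow> 'v"

text \<open>The quotient space \<open>V/W\<close>, whose elements are the cosets \<open>W + v\<close>, with the operation on
  cosets induced by \<open>op\<close>. For a coset \<open>X\<close> and a linear map \<open>f\<close> that preserves \<open>W\<close>, the union
  of the \<open>W + f v\<close> over \<open>v \<in> X\<close> is the single coset \<open>W + f v\<close>.\<close>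

definition quotient_module ::
  "(complex, 'v) module \<Rightarrow> 'v set \<Rightarrow> ('a \<Rightarrow> 'v \<Rightarrow> 'v) \<Rightarrow> ('a, 'v set) alg_module" where
  "quotient_module V W op =
    \<lparr> carrier = a_rcosets\<^bsub>V\<^esub> W, mult = undefined, one = undefined,
      zero = W, add = set_add V,
      smult = (\<lambda>c X. \<Union>v\<in>X. W +>\<^bsub>V\<^esub> (c \<odot>\<^bsub>V\<^esub> v)),
      act = (\<lambda>a X. \<Union>v\<in>X. W +>\<^bsub>V\<^esub> (op a v)) \<rparr>"


section \<open>Tensor product over an algebra\<close>

text \<open>\<open>M\<close> is a right and \<open>N\<close> a left module over the algebra with underlying set \<open>B\<close>, the
  operations being \<open>ra\<close> and \<open>la\<close>. The relations say that \<open>(x, y) \<mapsto> x \<otimes> y\<close> is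
  complex bilinear and \<open>B\<close>-balanced.\<close>

definition tensor_relations ::
  "'b set \<Rightarrow> (complex, 'm) module \<Rightarrow> ('m \<Rightarrow> 'b \<Rightarrow> 'm) \<Rightarrow> (complex, 'n) module \<Rightarrow> ('b \<Rightarrow> 'n \<Rightarrow> 'n)
    \<Rightarrow> ('m \<times> 'n \<Rightarrow>\<^sub>0 complex) set" where
  "tensor_relations B M ra N la =
     {basis_vec (x \<oplus>\<^bsub>M\<^esub> x', y) - basis_vec (x, y) - basis_vec (x', y) | x x' y.
        x \<in> carrier M \<and> x' \<in> carrier M \<and> y \<in> carrier N}
   \<union> {basis_vec (x, y \<oplus>\<^bsub>N\<^esub> y') - basis_vec (x, y) - basis_vec (x, y') | x y y'.
        x \<in> carrier M \<and> y \<in> carrier N \<and> y' \<in> carrier N}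
   \<union> {basis_vec (c \<odot>\<^bsub>M\<^esub> x, y) - cscale c (basis_vec (x, y)) | c x y.
        x \<in> carrier M \<and> y \<in> carrier N}
   \<union> {basis_vec (x, c \<odot>\<^bsub>N\<^esub> y) - cscale c (basis_vec (x, y)) | c x y.
        x \<in> carrier M \<and> y \<in> carrier N}
   \<union> {basis_vec (ra x b, y) - basis_vec (x, la b y) | x b y.
        x \<in> carrier M \<and> b \<in> B \<and> y \<in> carrier N}"

text \<open>If moreover \<open>M\<close> is a bimodule with left operation \<open>op\<close>, the tensor product carries the
  left operation determined by \<open>a \<cdot> (x \<otimes> y) = (a \<cdot> x) \<otimes> y\<close>.\<close>

definition tensor_module ::
  "('a \<Rightarrow> 'm \<Rightarrow> 'm) \<Rightarrow> 'b set \<Rightarrow> (complex, 'm) module \<Rightarrow> ('m \<Rightarrow> 'b \<Rightarrow> 'm)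
    \<Rightarrow> (complex, 'n) module \<Rightarrow> ('b \<Rightarrow> 'n \<Rightarrow> 'n) \<Rightarrow> ('a, ('m \<times> 'n \<Rightarrow>\<^sub>0 complex) set) alg_module" where
  "tensor_module op B M ra N la =
    (let F = free_space (carrier M \<times> carrier N) in
     quotient_module F
       (LinearCombinations.module.span class_ring F (tensor_relations B M ra N la))
       (\<lambda>a. lin_ext (\<lambda>(x, y). basis_vec (op a x, y))))"


section \<open>Partial functions\<close>

text \<open>\<^term>\<open>f \<circ>\<^sub>m g\<close> is composition from right to left: first \<open>g\<close>, then \<open>f\<close>.\<close>

definition PT :: "nat \<Rightarrow> (nat \<rightharpoonup> nat) set" where
  "PT n = {f. dom f \<subseteq> {1..n} \<and> ran f \<subseteq> {1..n}}"

definition partial_id :: "nat set \<Rightarrow> (nat \<rightharpoonup> nat)" where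
  "partial_id A = Some |` A"

definition partial_ids :: "nat \<Rightarrow> (nat \<rightharpoonup> nat) set" where
  "partial_ids n = {partial_id A | A. A \<subseteq> {1..n}}"

definition Ltilde :: "nat \<Rightarrow> (nat \<rightharpoonup> nat) \<Rightarrow> (nat \<rightharpoonup> nat) \<Rightarrow> bool" where
  "Ltilde n a b \<longleftrightarrow> (\<forall>e\<in>partial_ids n. a \<circ>\<^sub>m e = a \<longleftrightarrow> b \<circ>\<^sub>m e = b)"

definition Ltilde_class :: "nat \<Rightarrow> nat \<Rightarrow> (nat \<rightharpoonup> nat) set" where
  "Ltilde_class n k = {f \<in> PT n. Ltilde n f (partial_id {1..k})}"

definition group_algebra :: "nat \<Rightarrow> ((nat \<Rightarrow> nat) \<Rightarrow>\<^sub>0 complex) set" where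
  "group_algebra k = carrier (free_space (carrier (sym_group k)))"

text \<open>The operation of the monoid algebra of \<^term>\<open>PT n\<close> on the free space over
  \<^term>\<open>Ltilde_class n k\<close>, and the right operation of the group algebra of the symmetric group.
  A permutation of \<open>{1..k}\<close> acts as the partial function with domain \<open>{1..k}\<close>.\<close>

definition PT_act ::
  "nat \<Rightarrow> nat \<Rightarrow> ((nat \<rightharpoonup> nat) \<Rightarrow>\<^sub>0 complex) \<Rightarrow> ((nat \<rightharpoonup> nat) \<Rightarrow>\<^sub>0 complex) \<Rightarrow> ((nat \<rightharpoonup> nat) \<Rightarrow>\<^sub>0 complex)" where
  "PT_act n k a v =
    lin_ext (\<lambda>s. lin_ext (\<lambda>x. if s \<circ>\<^sub>m x \<in> Ltilde_class n k then basis_vec (s \<circ>\<^sub>m x) else 0) v) a"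

definition right_sym_act ::
  "nat \<Rightarrow> ((nat \<rightharpoonup> nat) \<Rightarrow>\<^sub>0 complex) \<Rightarrow> ((nat \<Rightarrow> nat) \<Rightarrow>\<^sub>0 complex) \<Rightarrow> ((nat \<rightharpoonup> nat) \<Rightarrow>\<^sub>0 complex)" where
  "right_sym_act k v b =
    lin_ext (\<lambda>p. lin_ext (\<lambda>x. basis_vec (x \<circ>\<^sub>m ((Some \<circ> p) |` {1..k}))) v) b"


section \<open>Partitions, compositions, Kostka numbers\<close>

definition is_composition :: "nat list \<Rightarrow> nat \<Rightarrow> bool" where
  "is_composition mu k \<longleftrightarrow> (\<forall>x\<in>set mu. 0 < x) \<and> sum_list mu = k"

definition is_partition :: "nat list \<Rightarrow> nat \<Rightarrow> bool" where
  "is_partition lam k \<longleftrightarrow> is_composition lam k \<and> sorted_wrt (\<ge>) lam"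

text \<open>The cell \<open>(i, j)\<close> lies in row \<open>i\<close> and column \<open>j\<close>, both counted from 0.\<close>

definition diagram :: "nat list \<Rightarrow> (nat \<times> nat) set" where
  "diagram lam = {(i, j). i < length lam \<and> j < lam ! i}"

text \<open>Entries of a tableau of content \<open>mu\<close> are \<open>1, \<dots>, length mu\<close>, so that \<open>mu ! i\<close> is the
  multiplicity of \<open>Suc i\<close>. Tableaux are extensional functions, hence counted once each.\<close>

definition SSYT :: "nat list \<Rightarrow> nat list \<Rightarrow> (nat \<times> nat \<Rightarrow> nat) set" where
  "SSYT lam mu =
    {T \<in> diagram lam \<rightarrow>\<^sub>E {1..length mu}.
      (\<forall>i j j'. (i, j) \<in> diagram lam \<and> (i, j') \<in> diagram lam \<and> j < j' \<longrightarrow> T (i, j) \<le> T (i, j')) \<and>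
      (\<forall>i i' j. (i, j) \<in> diagram lam \<and> (i', j) \<in> diagram lam \<and> i < i' \<longrightarrow> T (i, j) < T (i', j)) \<and>
      (\<forall>i<length mu. card {c \<in> diagram lam. T c = Suc i} = mu ! i)}"

definition kostka :: "nat list \<Rightarrow> nat list \<Rightarrow> nat" where
  "kostka lam mu = card (SSYT lam mu)"


section \<open>Specht modules\<close>

text \<open>The construction by polytabloids. A tabloid (a tableau with unordered rows) is represented
  by the list of its sets of row entries. For the one-row shape there is a single tabloid, so the
  Specht module is the trivial module.\<close>

definition is_tableau :: "nat \<Rightarrow> nat list \<Rightarrow> (nat \<times> nat \<Rightarrow> nat) \<Rightarrow> bool" where
  "is_tableau k lam t \<longleftrightarrow> bij_betw t (diagram lam) {1..k}"

definition tabloid :: "nat list \<Rightarrow> (nat \<times> nat \<Rightarrow> nat) \<Rightarrow> nat set list" where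
  "tabloid lam t = map (\<lambda>i. t ` {c \<in> diagram lam. fst c = i}) [0..<length lam]"

definition tabloids :: "nat \<Rightarrow> nat list \<Rightarrow> nat set list set" where
  "tabloids k lam = {tabloid lam t | t. is_tableau k lam t}"

definition column_stabilizer :: "nat \<Rightarrow> nat list \<Rightarrow> (nat \<times> nat \<Rightarrow> nat) \<Rightarrow> (nat \<Rightarrow> nat) set" where
  "column_stabilizer k lam t =
    {p \<in> carrier (sym_group k).
      \<forall>j. p ` t ` {c \<in> diagram lam. snd c = j} = t ` {c \<in> diagram lam. snd c = j}}"

definition polytabloid :: "nat \<Rightarrow> nat list \<Rightarrow> (nat \<times> nat \<Rightarrow> nat) \<Rightarrow> (nat set list \<Rightarrow>\<^sub>0 complex)" where
  "polytabloid k lam t =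
    (\<Sum>p\<in>column_stabilizer k lam t. cscale (of_int (sign p)) (basis_vec (tabloid lam (p \<circ> t))))"

definition specht :: "nat \<Rightarrow> nat list \<Rightarrow> (complex, nat set list \<Rightarrow>\<^sub>0 complex) module" where
  "specht k lam =
    (let F = free_space (tabloids k lam) in
     F\<lparr>carrier := LinearCombinations.module.span class_ring F
                    {polytabloid k lam t | t. is_tableau k lam t}\<rparr>)"

definition specht_act ::
  "((nat \<Rightarrow> nat) \<Rightarrow>\<^sub>0 complex) \<Rightarrow> (nat set list \<Rightarrow>\<^sub>0 complex) \<Rightarrow> (nat set list \<Rightarrow>\<^sub>0 complex)" where
  "specht_act b w = lin_ext (\<lambda>p. lin_ext (\<lambda>T. basis_vec (map ((`) p) T)) w) b"


section \<open>The modules of the theorem\<close>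

definition PT_module :: "nat \<Rightarrow> nat \<Rightarrow> nat list \<Rightarrow>
    ((nat \<rightharpoonup> nat) \<Rightarrow>\<^sub>0 complex, (((nat \<rightharpoonup> nat) \<Rightarrow>\<^sub>0 complex) \<times> (nat set list \<Rightarrow>\<^sub>0 complex) \<Rightarrow>\<^sub>0 complex) set)
      alg_module" where
  "PT_module n k lam =
    tensor_module (PT_act n k) (group_algebra k)
      (free_space (Ltilde_class n k)) (right_sym_act k)
      (specht k lam) specht_act"

text \<open>The class of the partial identity is what it should be.\<close>

lemma Ltilde_class_eq:
  assumes "k \<le> n"
  shows "Ltilde_class n k = {f \<in> PT n. dom f = {1..k}}"
proof -
  have comp: "f \<circ>\<^sub>m partial_id A = f \<longleftrightarrow> dom f \<subseteq> A" for f :: "nat \<rightharpoonup> nat" and A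
  proof -
    have "f \<circ>\<^sub>m partial_id A = f |` A"
      by (auto simp: fun_eq_iff map_comp_def partial_id_def restrict_map_def)
    moreover have "dom (f |` A) = dom f \<inter> A" by (rule dom_restrict)
    moreover have "f |` A = f" if "dom f \<subseteq> A"
    proof
      fix x
      show "(f |` A) x = f x" using that by (cases "x \<in> A"; cases "f x") (auto simp: dom_def)
    qed
    ultimately show ?thesis by (metis inf.cobounded2)
  qed
  have dk: "dom (partial_id {1..k}) = {1..k}"
    by (auto simp: partial_id_def dom_def restrict_map_def)
  have L: "Ltilde n f (partial_id {1..k}) \<longleftrightarrow> (\<forall>A\<subseteq>{1..n}. dom f \<subseteq> A \<longleftrightarrow> {1..k} \<subseteq> A)" for f
  proof -
    have "Ltilde n f (partial_id {1..k}) \<longleftrightarrow>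
        (\<forall>A\<subseteq>{1..n}. f \<circ>\<^sub>m partial_id A = f \<longleftrightarrow>
          partial_id {1..k} \<circ>\<^sub>m partial_id A = partial_id {1..k})"
    proof -
      have ball: "(\<forall>e\<in>partial_ids n. P e) \<longleftrightarrow> (\<forall>A\<subseteq>{1..n}. P (partial_id A))" for P
        by (auto simp: partial_ids_def)
      show ?thesis unfolding Ltilde_def by (rule ball)
    qed
    then show ?thesis by (simp only: comp dk)
  qed
  have "Ltilde n f (partial_id {1..k}) \<longleftrightarrow> dom f = {1..k}" if "f \<in> PT n" for f
  proof -
    have "dom f \<subseteq> {1..n}" "{1..k} \<subseteq> {1..n}" using that assms by (auto simp: PT_def)
    then show ?thesis
      unfolding L by (metis order_refl subset_antisym)
  qed
  then show ?thesis unfolding Ltilde_class_def by blast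
qed

text \<open>A positive number has no composition with 0 parts, so that letting \<open>l\<close> start from 0 instead of
  1 in the dimension formula only matters for \<open>k = 0\<close>. There the empty partition gives a module of
  dimension 1, which is accounted for by the empty composition.\<close>

lemma composition_sum_from_1:
  fixes g :: "nat \<Rightarrow> nat list \<Rightarrow> nat"
  assumes "1 \<le> k"
  shows "(\<Sum>l=0..k. \<Sum>mu | is_composition mu k \<and> length mu = l. g l mu) =
         (\<Sum>l=1..k. \<Sum>mu | is_composition mu k \<and> length mu = l. g l mu)"
proof -
  have "{mu. is_composition mu k \<and> length mu = 0} = {}"
    using assms by (auto simp: is_composition_def)
  then show ?thesis
    by (simp only: sum.atLeast_Suc_atMost[OF le0] One_nat_def sum.empty add_0)
qed

end

theory Submission
  imports Defs "HOL-Library.Infinite_Set"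
begin

text \<open>Fix a tableau \<open>t\<close> of shape \<open>lam\<close> with polytabloid \<open>e\<close>. As the \<open>S\<^sub>k\<close>-action can be moved across
  the tensor sign, the module is spanned by the \<open>x \<otimes> e\<close> for fillings \<open>x : {1..k} \<rightarrow> {1..n}\<close> of
  the cells of \<open>t\<close>. Column permutations act on them by signs, and summing \<open>sign s \<cdot> x s \<otimes> e\<close> over
  the permutations \<open>s\<close> of a Garnir set gives 0. These two relations rewrite every \<open>x \<otimes> e\<close> in terms
  of semistandard fillings, because they only introduce fillings with a bigger sum of
  \<open>column \<cdot> entry\<close>, or with the same such sum and a bigger sum of \<open>row \<cdot> entry\<close>.

  Conversely, send \<open>x \<otimes> T\<close>, for a tabloid \<open>T\<close>, to the list of the multisets of entries of \<open>x\<close> in the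
  rows of \<open>T\<close>. This respects the tensor relations and maps \<open>x \<otimes> e\<close> to a signed sum over the column
  permutations of \<open>x\<close>. For a semistandard \<open>x\<close> its leading term, with respect to the sum of
  \<open>row \<cdot> entry\<close>, is \<open>x\<close> itself, and \<open>x\<close> is determined by the multisets of its rows. So the
  semistandard \<open>x \<otimes> e\<close> are a basis; in particular the exactness of tensoring over the semisimple
  algebra of \<open>S\<^sub>k\<close> is not needed. Finally, the semistandard tableaux with entries in \<open>{1..n}\<close>
  are grouped by their sets of entries, which are relabelled monotonically to \<open>{1..l}\<close>.\<close>

subsection \<open>Linear algebra on free spaces\<close>

lemma lookup_cscale [simp]: "Poly_Mapping.lookup (cscale c v) x = c * Poly_Mapping.lookup v x"
  by (simp add: Poly_Mapping.map.rep_eq when_def)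

text \<open>Spans and subspaces are handled on the whole type through this interpretation; the
  notions based on carriers are translated to it.\<close>

global_interpretation free: vector_space "cscale :: complex \<Rightarrow> ('x \<Rightarrow>\<^sub>0 complex) \<Rightarrow> ('x \<Rightarrow>\<^sub>0 complex)"
  by unfold_locales (auto intro!: poly_mapping_eqI simp: lookup_add algebra_simps)

lemma cscale_minus_one [simp]: "cscale (- 1) v = - v"
  by (rule poly_mapping_eqI) simp

lemma basis_expansion: "v = (\<Sum>x\<in>Poly_Mapping.keys v. cscale (Poly_Mapping.lookup v x) (basis_vec x))"
  by (rule poly_mapping_eqI)
    (auto simp: lookup_sum lookup_single when_def sum.delta' in_keys_iff
      intro: if_cong cong: if_cong)

text \<open>This allows vectors with different supports to be summed over one common index set; the
  additional summands have coefficient 0.\<close>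

lemma lin_ext_superset:
  assumes "finite A" "Poly_Mapping.keys v \<subseteq> A"
  shows "lin_ext f v = (\<Sum>x\<in>A. cscale (Poly_Mapping.lookup v x) (f x))"
  unfolding lin_ext_def
  by (rule sum.mono_neutral_left) (use assms in \<open>auto simp: in_keys_iff\<close>)

lemma lin_ext_add: "lin_ext f (u + v) = lin_ext f u + lin_ext f v"
proof -
  let ?A = "Poly_Mapping.keys u \<union> Poly_Mapping.keys v"
  have *: "lin_ext f w = (\<Sum>x\<in>?A. cscale (Poly_Mapping.lookup w x) (f x))"
    if "Poly_Mapping.keys w \<subseteq> ?A" for w
    by (rule lin_ext_superset) (use that in auto)
  show ?thesis
    by (subst (1 2 3) *) (auto simp: keys_add lookup_add free.scale_left_distrib sum.distrib
        dest: subsetD[OF keys_add])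
qed

lemma lin_ext_scale: "lin_ext f (cscale c v) = cscale c (lin_ext f v)"
proof -
  have "lin_ext f (cscale c v) = (\<Sum>x\<in>Poly_Mapping.keys v. cscale (c * Poly_Mapping.lookup v x) (f x))"
    by (subst lin_ext_superset[of "Poly_Mapping.keys v"]) (auto simp: in_keys_iff)
  then show ?thesis
    by (simp add: lin_ext_def free.scale_sum_right)
qed

lemma lin_ext_zero [simp]: "lin_ext f 0 = 0"
  by (simp add: lin_ext_def)

lemma lin_ext_diff: "lin_ext f (u - v) = lin_ext f u - lin_ext f v"
  using lin_ext_add[of f "u - v" v] by simp

lemma lin_ext_sum: "lin_ext f (sum g I) = (\<Sum>i\<in>I. lin_ext f (g i))"
  by (induction I rule: infinite_finite_induct) (auto simp: lin_ext_add)

lemma lin_ext_basis [simp]: "lin_ext f (basis_vec x) = f x"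
  by (simp add: lin_ext_def)

lemma lin_ext_cong:
  "(\<And>x. x \<in> Poly_Mapping.keys v \<Longrightarrow> f x = g x) \<Longrightarrow> lin_ext f v = lin_ext g v"
  unfolding lin_ext_def by (rule sum.cong) auto

lemma lin_ext_lin_ext: "lin_ext f (lin_ext g v) = lin_ext (\<lambda>x. lin_ext f (g x)) v"
proof -
  have "lin_ext f (lin_ext g v)
      = (\<Sum>x\<in>Poly_Mapping.keys v. cscale (Poly_Mapping.lookup v x) (lin_ext f (g x)))"
    by (simp add: lin_ext_def[of g v] lin_ext_sum lin_ext_scale)
  then show ?thesis
    by (simp add: lin_ext_def[of "\<lambda>x. lin_ext f (g x)" v])
qed

lemma lin_ext_fun_add: "lin_ext (\<lambda>x. f x + g x) v = lin_ext f v + lin_ext g v"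
  by (simp add: lin_ext_def free.scale_right_distrib sum.distrib)

lemma lin_ext_fun_scale: "lin_ext (\<lambda>x. cscale c (f x)) v = cscale c (lin_ext f v)"
  by (simp add: lin_ext_def free.scale_sum_right mult.commute)

lemma lin_ext_commute:
  "lin_ext (\<lambda>x. lin_ext (f x) w) v = lin_ext (\<lambda>y. lin_ext (\<lambda>x. f x y) v) w"
  unfolding lin_ext_def
  by (simp add: free.scale_sum_right, subst sum.swap) (simp add: mult.commute)

section \<open>Free spaces as modules with a carrier\<close>

lemma carrier_free_space: "carrier (free_space X) = {v. Poly_Mapping.keys v \<subseteq> X}"
  and zero_free_space [simp]: "\<zero>\<^bsub>free_space X\<^esub> = 0"
  and add_free_space [simp]: "u \<oplus>\<^bsub>free_space X\<^esub> v = u + v"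
  and smult_free_space [simp]: "c \<odot>\<^bsub>free_space X\<^esub> v = cscale c v"
  by (simp_all add: free_space_def)

lemma carrier_free_space_eq_span: "carrier (free_space X) = free.span (basis_vec ` X)"
proof
  show "carrier (free_space X) \<subseteq> free.span (basis_vec ` X)"
  proof
    fix v assume "v \<in> carrier (free_space X)"
    then have "cscale (Poly_Mapping.lookup v x) (basis_vec x) \<in> free.span (basis_vec ` X)"
      if "x \<in> Poly_Mapping.keys v" for x
      using that by (intro free.span_scale free.span_base) (auto simp: carrier_free_space)
    then show "v \<in> free.span (basis_vec ` X)"
      by (subst basis_expansion) (rule free.span_sum)
  qed
next
  have "free.subspace {v::'a \<Rightarrow>\<^sub>0 complex. Poly_Mapping.keys v \<subseteq> X}"
    by (auto simp: free.subspace_def in_keys_iff dest!: subsetD[OF keys_add])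
  then show "free.span (basis_vec ` X) \<subseteq> carrier (free_space X)"
    unfolding carrier_free_space by (intro free.span_minimal) auto
qed

lemma subspace_carrier_free_space: "free.subspace (carrier (free_space X))"
  by (simp add: carrier_free_space_eq_span)

lemma class_cring: "cring (class_ring :: complex ring)"
  using class_field field.axioms(1) domain.axioms(1) by blast

lemma free_space_module: "Module.module class_ring (free_space X :: (complex, 'x \<Rightarrow>\<^sub>0 complex) module)"
proof (rule module_criteria)
  note [simp] = carrier_free_space_eq_span
  show "\<forall>v\<in>carrier (free_space X). \<exists>neg_v\<in>carrier (free_space X).
      v \<oplus>\<^bsub>free_space X\<^esub> neg_v = \<zero>\<^bsub>free_space X\<^esub>"
  proof
    fix v assume "v \<in> carrier (free_space X)"
    then show "\<exists>neg_v\<in>carrier (free_space X). v \<oplus>\<^bsub>free_space X\<^esub> neg_v = \<zero>\<^bsub>free_space X\<^esub>"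
      by (intro bexI[of _ "- v"]) (auto intro: free.span_neg)
  qed
qed (auto simp: carrier_free_space_eq_span class_cring
    free.scale_left_distrib free.scale_right_distrib algebra_simps
    intro: free.span_add free.span_scale free.span_zero)

text \<open>Both spans consist of finite linear combinations. This is the bridge from the span used
  to define Specht modules and tensor products to \<open>free.span\<close>.\<close>

lemma span_free_space_eq:
  assumes "S \<subseteq> carrier (free_space X)"
  shows "LinearCombinations.module.span class_ring (free_space X) S = free.span S"
proof -
  interpret F: Module.module class_ring "free_space X :: (complex, 'a \<Rightarrow>\<^sub>0 complex) module"
    by (rule free_space_module)
  have lc: "F.lincomb a B = (\<Sum>v\<in>B. cscale (a v) v)" if "finite B" "B \<subseteq> S" for a B
    using that
  proof (induction B rule: finite_induct)
    case empty
    then show ?case by (simp add: F.lincomb_def)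
  next
    case (insert v B)
    have "(\<lambda>v. cscale (a v) v) \<in> B \<rightarrow> carrier (free_space X)"
      "cscale (a v) v \<in> carrier (free_space X)"
      using insert.prems assms subspace_carrier_free_space[of X]
      by (auto simp: free.subspace_def)
    then show ?case
      using insert by (simp add: F.lincomb_def)
  qed
  show ?thesis
  proof (intro equalityI subsetI)
    fix v assume "v \<in> F.span S"
    then obtain a B where "v = F.lincomb a B" "finite B" "B \<subseteq> S"
      by (auto simp: F.span_def)
    then show "v \<in> free.span S"
      by (auto simp: lc intro!: free.span_sum free.span_scale intro: free.span_base)
  next
    fix v assume "v \<in> free.span S"
    then obtain a B where "v = F.lincomb a B" "finite B" "B \<subseteq> S"
      by (auto simp: free.span_explicit lc)
    then show "v \<in> F.span S"
      by (auto simp: F.span_def)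
  qed
qed

section \<open>Quotients of a free space and their dimension\<close>

context
  fixes X :: "'x set" and W :: "('x \<Rightarrow>\<^sub>0 complex) set"
    and op :: "'a \<Rightarrow> ('x \<Rightarrow>\<^sub>0 complex) \<Rightarrow> ('x \<Rightarrow>\<^sub>0 complex)"
  assumes W: "free.subspace W" "W \<subseteq> carrier (free_space X)"
begin

abbreviation (input) "Q \<equiv> quotient_module (free_space X) W op"
abbreviation (input) "coset v \<equiv> W +>\<^bsub>free_space X\<^esub> v"

lemma coset_altdef: "coset v = {u. u - v \<in> W}"
proof -
  have "u \<in> coset v \<longleftrightarrow> (\<exists>w\<in>W. u = w + v)" for u
    by (simp add: a_r_coset_def r_coset_def)
  then show ?thesis by (auto simp: diff_eq_eq) (metis diff_eq_eq)
qed

lemma coset_eq_iff: "coset u = coset v \<longleftrightarrow> u - v \<in> W"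
proof
  assume "coset u = coset v"
  moreover have "u \<in> coset u"
    using W(1) by (simp add: coset_altdef free.subspace_0)
  ultimately show "u - v \<in> W" by (simp add: coset_altdef)
next
  assume uv: "u - v \<in> W"
  have "x - u \<in> W \<longleftrightarrow> x - v \<in> W" for x
    using free.subspace_add[OF W(1) _ uv, of "x - u"] free.subspace_diff[OF W(1) _ uv, of "x - v"]
    by auto
  then show "coset u = coset v" by (simp add: coset_altdef)
qed

lemma carrier_quotient: "carrier Q = (\<lambda>v. coset v) ` carrier (free_space X)"
  by (auto simp: quotient_module_def A_RCOSETS_def RCOSETS_def a_r_coset_def)

lemma add_quotient: "coset u \<oplus>\<^bsub>Q\<^esub> coset v = coset (u + v)"
proof -
  have "\<exists>a. a - u \<in> W \<and> (\<exists>b. b - v \<in> W \<and> x = a + b)" if "x - (u + v) \<in> W" for x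
    using that W(1) by (intro exI[of _ "x - v"] conjI exI[of _ v])
      (auto simp: algebra_simps free.subspace_0)
  moreover have "a + b - (u + v) \<in> W" if "a - u \<in> W" "b - v \<in> W" for a b
    using free.subspace_add[OF W(1) that] by (simp add: algebra_simps)
  ultimately show ?thesis
    by (simp add: quotient_module_def set_add_def set_mult_def coset_altdef) blast
qed

text \<open>The union over all representatives collapses: \<open>W\<close> is closed under scaling,
  so every representative yields the same coset.\<close>

lemma smult_quotient: "c \<odot>\<^bsub>Q\<^esub> coset v = coset (cscale c v)"
proof -
  have eq: "coset (cscale c u) = coset (cscale c v)" if "u \<in> coset v" for u
  proof -
    have "u - v \<in> W" using that by (simp add: coset_altdef)
    then have "cscale c (u - v) \<in> W" by (rule free.subspace_scale[OF W(1)])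
    then show ?thesis unfolding coset_eq_iff free.scale_right_diff_distrib .
  qed
  have ne: "v \<in> coset v"
    using W(1) by (simp add: coset_altdef free.subspace_0)
  have "c \<odot>\<^bsub>Q\<^esub> coset v = (\<Union>u\<in>coset v. coset (cscale c u))"
    by (simp add: quotient_module_def)
  also have "\<dots> = (\<Union>u\<in>coset v. coset (cscale c v))"
    by (rule SUP_cong[OF refl eq])
  finally show ?thesis using ne by auto
qed

lemma zero_quotient: "\<zero>\<^bsub>Q\<^esub> = coset 0"
  by (simp add: quotient_module_def coset_altdef)

lemma quotient_vectorspace: "vectorspace class_ring Q"
proof (rule vectorspace.intro[OF _ class_field], rule module_criteria)
  show "\<forall>v\<in>carrier Q. \<exists>neg_v\<in>carrier Q. v \<oplus>\<^bsub>Q\<^esub> neg_v = \<zero>\<^bsub>Q\<^esub>"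
  proof
    fix v assume "v \<in> carrier Q"
    then obtain u where u: "u \<in> carrier (free_space X)" "v = coset u"
      by (auto simp: carrier_quotient)
    then have "coset (- u) \<in> carrier Q"
      unfolding carrier_quotient
      by (intro imageI free.subspace_neg[OF subspace_carrier_free_space])
    then show "\<exists>neg_v\<in>carrier Q. v \<oplus>\<^bsub>Q\<^esub> neg_v = \<zero>\<^bsub>Q\<^esub>"
      by (rule bexI[rotated]) (simp add: u add_quotient zero_quotient)
  qed
  show "\<forall>v w. v \<in> carrier Q \<and> w \<in> carrier Q \<longrightarrow> v \<oplus>\<^bsub>Q\<^esub> w \<in> carrier Q"
    by (auto simp: carrier_quotient add_quotient
        intro!: imageI free.subspace_add[OF subspace_carrier_free_space])
  show "\<forall>c v. c \<in> carrier class_ring \<and> v \<in> carrier Q \<longrightarrow> c \<odot>\<^bsub>Q\<^esub> v \<in> carrier Q"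
    by (auto simp: carrier_quotient smult_quotient
        intro!: imageI free.subspace_scale[OF subspace_carrier_free_space])
  show "\<zero>\<^bsub>Q\<^esub> \<in> carrier Q"
    by (auto simp: carrier_quotient zero_quotient
        intro!: imageI free.subspace_0[OF subspace_carrier_free_space])
qed (insert class_cring, (clarsimp simp: carrier_quotient add_quotient smult_quotient zero_quotient
    free.scale_left_distrib free.scale_right_distrib add_ac)+)

text \<open>The cosets of the \<open>f i\<close> form a basis: \<open>span\<close> makes them
  generate the quotient and \<open>indep\<close> makes them independent. The dimension of the tensor
  product is computed by this criterion.\<close>

lemma dim_quotient:
  fixes f :: "'i \<Rightarrow> ('x \<Rightarrow>\<^sub>0 complex)"
  assumes I: "finite I" "\<And>i. i \<in> I \<Longrightarrow> f i \<in> carrier (free_space X)"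
    and span: "carrier (free_space X) \<subseteq> free.span (W \<union> f ` I)"
    and indep: "\<And>c i. (\<Sum>i\<in>I. cscale (c i) (f i)) \<in> W \<Longrightarrow> i \<in> I \<Longrightarrow> c i = 0"
  shows "vectorspace.dim class_ring Q = card I"
proof -
  interpret Q: vectorspace class_ring Q by (rule quotient_vectorspace)
  define g where "g i = coset (f i)" for i
  have inj: "inj_on g I"
  proof
    fix i j assume ij: "i \<in> I" "j \<in> I" "g i = g j"
    \<comment> \<open>These are the coefficients of \<open>f i - f j\<close>, which lies in
      \<open>W\<close> because the cosets agree. For \<open>i \<noteq> j\<close> the coefficient at
      \<open>i\<close> would be 1, against \<open>indep\<close>.\<close>
    define c where "c l = (if l = i then 1 else 0) - (if l = j then 1 else (0::complex))" for l
    have "(\<Sum>l\<in>I. cscale (c l) (f l)) = f i - f j"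
      using ij I(1)
      by (intro poly_mapping_eqI)
        (simp add: c_def lookup_sum lookup_minus left_diff_distrib sum_subtractf
          if_distrib[of "\<lambda>a. a * _"] sum.delta cong: if_cong)
    then have "c i = 0"
      using ij by (intro indep) (auto simp: g_def coset_eq_iff)
    then show "i = j" by (auto simp: c_def split: if_splits)
  qed
  have gQ: "g ` I \<subseteq> carrier Q"
    using I(2) by (auto simp: g_def carrier_quotient)
  have lc: "Q.lincomb a (g ` J) = coset (\<Sum>i\<in>J. cscale (a (g i)) (f i))" if "J \<subseteq> I" for a J
  proof -
    have "finite J" using that I(1) finite_subset by blast
    then show ?thesis using that
    proof (induction J rule: finite_induct)
      case empty
      then show ?case by (simp add: Q.lincomb_def zero_quotient)
    next
      case (insert i J)
      have "g i \<notin> g ` J"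
        using insert inj by (auto dest: inj_onD)
      then have "Q.lincomb a (g ` insert i J) = a (g i) \<odot>\<^bsub>Q\<^esub> g i \<oplus>\<^bsub>Q\<^esub> Q.lincomb a (g ` J)"
        using insert Q.lincomb_insert[of "g ` J" a "g i"] gQ
          image_mono[OF insert_subset[THEN iffD1, THEN conjunct2, OF insert.prems], of g]
        by (simp add: image_subset_iff subset_iff)
      then show ?case
        using insert by (simp add: g_def smult_quotient add_quotient)
    qed
  qed
  have "Q.basis (g ` I)"
    unfolding Q.basis_def
  proof (intro conjI)
    show "Q.lin_indpt (g ` I)"
    proof (rule Q.finite_lin_indpt2)
      fix a assume "Q.lincomb a (g ` I) = \<zero>\<^bsub>Q\<^esub>"
      then have "(\<Sum>i\<in>I. cscale (a (g i)) (f i)) \<in> W"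
        by (simp add: lc zero_quotient coset_eq_iff)
      then show "\<forall>v\<in>g ` I. a v = \<zero>\<^bsub>class_ring\<^esub>"
        using indep[of "\<lambda>i. a (g i)"] by auto
    qed (use I gQ in auto)
    \<comment> \<open>The vectors whose cosets lie in the span form a subspace; it contains
      \<open>W\<close>, whose elements have coset zero, and every \<open>f i\<close>.\<close>
    have "coset u \<in> Q.span (g ` I)" if "u \<in> free.span (W \<union> f ` I)" for u
      using that
    proof (rule free.span_induct[where P = "\<lambda>u. coset u \<in> Q.span (g ` I)"])
      have sm: "submodule class_ring (Q.span (g ` I)) Q"
        by (rule Q.span_is_submodule[OF gQ])
      show "free.subspace {u. coset u \<in> Q.span (g ` I)}"
        using submodule.zero_closed[OF sm] submodule.m_closed[OF sm] submodule.smult_closed[OF sm]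
        by (auto simp: free.subspace_def zero_quotient add_quotient[symmetric] smult_quotient[symmetric])
      fix u assume "u \<in> W \<union> f ` I"
      then show "coset u \<in> Q.span (g ` I)"
      proof
        assume "u \<in> W"
        then have "coset u = \<zero>\<^bsub>Q\<^esub>" by (simp add: zero_quotient coset_eq_iff)
        then show ?thesis using submodule.zero_closed[OF sm] by simp
      next
        assume "u \<in> f ` I"
        then have "coset u \<in> g ` I" by (auto simp: g_def)
        then show ?thesis using Q.in_own_span[OF gQ] by blast
      qed
    qed
    then have "carrier Q \<subseteq> Q.span (g ` I)"
      using span by (auto simp: carrier_quotient)
    then show "Q.gen_set (g ` I)"
      using Q.span_is_subset2[OF gQ] by blast
  qed (rule gQ)
  then have "Q.dim = card (g ` I)"
    using I(1) by (intro Q.dim_basis) auto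
  then show ?thesis by (simp add: card_image[OF inj])
qed

end

subsection \<open>Straightening of fillings\<close>

lemma diagram_downward_closed:
  assumes "is_partition lam k" "(i, j) \<in> diagram lam" "i' \<le> i" "j' \<le> j"
  shows "(i', j') \<in> diagram lam"
proof -
  have "lam ! i \<le> lam ! i'"
    using assms sorted_wrt_nth_less[of "(\<ge>)" lam i' i]
    by (cases "i' = i") (auto simp: is_partition_def diagram_def)
  then show ?thesis using assms by (auto simp: diagram_def)
qed

locale young_tableau =
  fixes k :: nat and lam :: "nat list" and t :: "nat \<times> nat \<Rightarrow> nat"
  assumes partition: "is_partition lam k" and tableau: "is_tableau k lam t"
begin

text \<open>The inverse of \<open>t\<close>. A filling is given as a function \<open>x\<close> on
  the numbers \<open>1\<close> to \<open>k\<close>, so that permutations act by composition; its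
  entry in the cell \<open>cell m\<close> is \<open>x m\<close>.\<close>

definition cell :: "nat \<Rightarrow> nat \<times> nat" where "cell = inv_into (diagram lam) t"

abbreviation row :: "nat \<Rightarrow> nat" where "row m \<equiv> fst (cell m)"
abbreviation col :: "nat \<Rightarrow> nat" where "col m \<equiv> snd (cell m)"

lemma bij: "bij_betw t (diagram lam) {1..k}"
  using tableau by (simp add: is_tableau_def)

lemma cell_t [simp]: "c \<in> diagram lam \<Longrightarrow> cell (t c) = c"
  unfolding cell_def by (rule bij_betw_inv_into_left[OF bij])

lemma t_cell [simp]: "m \<in> {1..k} \<Longrightarrow> t (cell m) = m"
  unfolding cell_def by (rule bij_betw_inv_into_right[OF bij])

lemma cell_in_diagram: "m \<in> {1..k} \<Longrightarrow> cell m \<in> diagram lam"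
  unfolding cell_def using bij_betw_apply[OF bij_betw_inv_into[OF bij]] by simp

lemma t_in: "c \<in> diagram lam \<Longrightarrow> t c \<in> {1..k}"
  by (rule bij_betw_apply[OF bij])

lemma cell_eqD: "cell m = cell m' \<Longrightarrow> m \<in> {1..k} \<Longrightarrow> m' \<in> {1..k} \<Longrightarrow> m = m'"
  by (metis t_cell)

lemma cell_eqI:
  assumes "m \<in> {1..k}" "m' \<in> {1..k}" "row m = row m'" "col m = col m'"
  shows "m = m'"
  by (rule cell_eqD[OF prod_eqI assms(1,2)]) (fact assms)+

lemma cell_cases:
  assumes "m \<in> {1..k}" "m' \<in> {1..k}" "m \<noteq> m'"
  shows "row m < row m' \<or> row m' < row m \<or> col m < col m' \<or> col m' < col m"
  using cell_eqD[of m m'] assms by (metis linorder_neqE_nat prod.expand)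

lemma cell_exists:
  assumes "(i, j) \<in> diagram lam"
  obtains m where "m \<in> {1..k}" "row m = i" "col m = j"
  using t_in[OF assms] cell_t[OF assms] by (metis fst_conv snd_conv)

definition row_set :: "nat \<Rightarrow> nat set" where "row_set i = {m \<in> {1..k}. row m = i}"

lemma image_row: "t ` {c \<in> diagram lam. fst c = i} = row_set i"
proof (intro equalityI subsetI)
  fix m assume "m \<in> row_set i"
  then show "m \<in> t ` {c \<in> diagram lam. fst c = i}"
    by (intro image_eqI[of _ _ "cell m"]) (auto simp: row_set_def cell_in_diagram)
qed (use t_in in \<open>auto simp: row_set_def\<close>)

lemma image_column: "t ` {c \<in> diagram lam. snd c = j} = {m \<in> {1..k}. col m = j}"
proof (intro equalityI subsetI)
  fix m assume "m \<in> {m \<in> {1..k}. col m = j}"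
  then show "m \<in> t ` {c \<in> diagram lam. snd c = j}"
    by (intro image_eqI[of _ _ "cell m"]) (auto simp: cell_in_diagram)
qed (use t_in in auto)

section \<open>The column group of the tableau\<close>

definition columns :: "(nat \<Rightarrow> nat) set" where
  "columns = {p. p permutes {1..k} \<and> (\<forall>m\<in>{1..k}. col (p m) = col m)}"

text \<open>A permutation mapping each column into itself maps it onto itself, since columns are
  finite.\<close>

lemma column_stabilizer_eq: "column_stabilizer k lam t = columns"
proof -
  have "(\<forall>j. p ` {m \<in> {1..k}. col m = j} = {m \<in> {1..k}. col m = j}) \<longleftrightarrow>
      (\<forall>m\<in>{1..k}. col (p m) = col m)" if p: "p permutes {1..k}" for p
  proof (intro iffI ballI allI)
    fix m assume "\<forall>j. p ` {m \<in> {1..k}. col m = j} = {m \<in> {1..k}. col m = j}" "m \<in> {1..k}"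
    then have "p m \<in> {m' \<in> {1..k}. col m' = col m}" by blast
    then show "col (p m) = col m" by simp
  next
    fix j assume *: "\<forall>m\<in>{1..k}. col (p m) = col m"
    show "p ` {m \<in> {1..k}. col m = j} = {m \<in> {1..k}. col m = j}"
    proof (rule card_subset_eq)
      show "p ` {m \<in> {1..k}. col m = j} \<subseteq> {m \<in> {1..k}. col m = j}"
        using * permutes_in_image[OF p] by auto
      show "card (p ` {m \<in> {1..k}. col m = j}) = card {m \<in> {1..k}. col m = j}"
        by (intro card_image inj_on_subset[OF permutes_inj[OF p]]) auto
    qed auto
  qed
  then show ?thesis
    unfolding column_stabilizer_def columns_def image_column sym_group_carrier by blast
qed

lemma columns_permutes: "p \<in> columns \<Longrightarrow> p permutes {1..k}"
  by (simp add: columns_def)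

lemma columns_col: "p \<in> columns \<Longrightarrow> m \<in> {1..k} \<Longrightarrow> col (p m) = col m"
  by (simp add: columns_def)

lemma finite_columns: "finite columns"
  by (rule finite_subset[of _ "{p. p permutes {1..k}}"]) (auto simp: columns_def finite_permutations)

lemma id_in_columns: "id \<in> columns"
  by (simp add: columns_def permutes_id)

lemma columns_compose:
  assumes "p \<in> columns" "q \<in> columns"
  shows "p \<circ> q \<in> columns"
  using assms permutes_in_image[of q "{1..k}"] by (auto simp: columns_def permutes_compose)

lemma columns_inv:
  assumes "p \<in> columns"
  shows "inv' p \<in> columns"
proof -
  have p: "p permutes {1..k}" by (rule columns_permutes[OF assms])
  have "col (inv' p m) = col m" if "m \<in> {1..k}" for m
    using columns_col[OF assms, of "inv' p m"] permutes_in_image[OF permutes_inv[OF p], of m] that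
    by (simp add: permutes_inverses(1)[OF p])
  then show ?thesis unfolding columns_def using permutes_inv[OF p] by blast
qed

lemma transpose_in_columns:
  assumes "a \<in> {1..k}" "b \<in> {1..k}" "col a = col b"
  shows "Transposition.transpose a b \<in> columns"
  using assms by (auto simp: columns_def permutes_swap_id transpose_def)

section \<open>Semistandard fillings and their weights\<close>

definition column_strict :: "(nat \<Rightarrow> nat) \<Rightarrow> bool" where
  "column_strict x \<longleftrightarrow> (\<forall>a\<in>{1..k}. \<forall>b\<in>{1..k}. col a = col b \<and> row a < row b \<longrightarrow> x a < x b)"

definition row_weak :: "(nat \<Rightarrow> nat) \<Rightarrow> bool" where
  "row_weak x \<longleftrightarrow> (\<forall>a\<in>{1..k}. \<forall>b\<in>{1..k}. row a = row b \<and> col a < col b \<longrightarrow> x a \<le> x b)"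

definition row_sum :: "(nat \<Rightarrow> nat) \<Rightarrow> nat" where
  "row_sum x = (\<Sum>m\<in>{1..k}. row m * x m)"

definition col_sum :: "(nat \<Rightarrow> nat) \<Rightarrow> nat" where
  "col_sum x = (\<Sum>m\<in>{1..k}. col m * x m)"

text \<open>The gain is \<open>(row b - row a) * (x a - x b)\<close>. The two factors appear as
  \<open>d\<close> and \<open>e\<close>, which avoids subtraction of natural numbers.\<close>

lemma row_sum_transpose:
  assumes ab: "a \<in> {1..k}" "b \<in> {1..k}" "row a < row b" and x: "x b < x a"
  shows "row_sum x < row_sum (x \<circ> Transposition.transpose a b)"
proof -
  have split: "row_sum y = row a * y a + row b * y b + (\<Sum>m\<in>{1..k} - {a, b}. row m * y m)" for y
  proof -
    have "a \<noteq> b" using ab by auto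
    then show ?thesis
      unfolding row_sum_def using ab
      by (subst sum.subset_diff[of "{a, b}"]) auto
  qed
  obtain d where d: "row b = row a + d" "d > 0"
    using ab(3) less_imp_add_positive by metis
  obtain e where e: "x a = x b + e" "e > 0"
    using x less_imp_add_positive by metis
  have "(\<Sum>m\<in>{1..k} - {a, b}. row m * (x \<circ> Transposition.transpose a b) m)
      = (\<Sum>m\<in>{1..k} - {a, b}. row m * x m)"
    by (rule sum.cong) auto
  moreover have "row a * x a + row b * x b < row a * x b + row b * x a"
    using d e by (simp add: algebra_simps)
  ultimately show ?thesis
    by (simp add: split[of x] split[of "x \<circ> Transposition.transpose a b"])
qed

lemma col_sum_columns:
  assumes "p \<in> columns"
  shows "col_sum (x \<circ> p) = col_sum x"
proof -
  have "col_sum (x \<circ> p) = (\<Sum>m\<in>{1..k}. col (p m) * x (p m))"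
    unfolding col_sum_def by (rule sum.cong) (auto simp: columns_col[OF assms])
  also have "\<dots> = col_sum x"
    unfolding col_sum_def
    using sum.permute[OF columns_permutes[OF assms], of "\<lambda>m. col m * x m"] by (simp add: comp_def)
  finally show ?thesis .
qed

text \<open>Within each column, \<open>p\<close> is a strictly increasing bijection of a finite
  chain, hence the identity; the induction goes down the rows.\<close>

lemma strict_mono_perm_row:
  assumes p: "p \<in> columns"
    and mono: "\<And>a b. a \<in> {1..k} \<Longrightarrow> b \<in> {1..k} \<Longrightarrow> col a = col b \<Longrightarrow> row a < row b
      \<Longrightarrow> row (p a) < row (p b)"
  shows "p = id"
proof -
  have perm: "p permutes {1..k}" by (rule columns_permutes[OF p])
  have "p m = m" if "m \<in> {1..k}" for m
    using that
  proof (induction "row m" arbitrary: m rule: less_induct)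
    case less
    define m' where "m' = inv' p m"
    have m': "m' \<in> {1..k}" "p m' = m" "col m' = col m"
      unfolding m'_def using less.prems
      using permutes_in_image[OF permutes_inv[OF perm], of m] permutes_inverses(1)[OF perm, of m]
        columns_col[OF columns_inv[OF p], of m] by blast+
    have pm: "p m \<in> {1..k}" "col (p m) = col m"
      using less.prems permutes_in_image[OF perm, of m] columns_col[OF p, of m] by blast+
    consider "row (p m) < row m" | "row m < row (p m)" | "row (p m) = row m"
      by (rule linorder_cases)
    \<comment> \<open>If \<open>p m\<close> lies above \<open>m\<close>, it is fixed by induction,
      and injectivity gives \<open>p m = m\<close>. If it lies below, consider the preimage
      \<open>m'\<close> of \<open>m\<close>: above \<open>m\<close> it would be fixed, and below
      \<open>m\<close> it would violate monotonicity.\<close>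
    then show ?case
    proof cases
      case 1
      then have "p (p m) = p m" by (rule less.hyps) (rule pm)
      then show ?thesis by (rule injD[OF permutes_inj[OF perm]])
    next
      case 2
      consider "row m' < row m" | "row m' > row m" | "row m' = row m" by (rule linorder_cases)
      then show ?thesis
      proof cases
        case 1
        then have "p m' = m'" by (rule less.hyps) (rule m')
        then have "m' = m" using m'(2) by simp
        with \<open>p m' = m'\<close> show ?thesis by (simp only:)
      next
        case 2
        then have "row (p m) < row m" using mono[of m m'] m' less.prems by (simp only:)
        then show ?thesis using \<open>row m < row (p m)\<close> by simp
      next
        case 3
        then have "m' = m" by (intro cell_eqI[OF m'(1) less.prems _ m'(3)])
        with m'(2) show ?thesis by (simp only:)
      qed
    next
      case 3
      then show ?thesis by (intro cell_eqI[OF pm(1) less.prems _ pm(2)])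
    qed
  qed
  then have "p m = id m" for m
    using permutes_not_in[OF perm, of m] unfolding id_apply by blast
  then show ?thesis by (rule ext)
qed

text \<open>A maximiser of \<open>row_sum (x \<circ> p)\<close> makes \<open>x \<circ> p\<close> increase down the columns, since
  otherwise a transposition would improve it.\<close>

lemma row_sum_columns:
  assumes x: "column_strict x" and p: "p \<in> columns"
  shows "row_sum (x \<circ> p) < row_sum x \<or> p = id"
proof -
  have inj: "x a = x b \<Longrightarrow> a = b" if "a \<in> {1..k}" "b \<in> {1..k}" "col a = col b" for a b
    using x that cell_cases[of a b] unfolding column_strict_def
    by (metis less_irrefl)
  have max_id: "p = id" if p: "p \<in> columns" and
    max: "\<And>q. q \<in> columns \<Longrightarrow> row_sum (x \<circ> q) \<le> row_sum (x \<circ> p)" for p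
  proof (rule strict_mono_perm_row[OF p])
    fix a b assume ab: "a \<in> {1..k}" "b \<in> {1..k}" "col a = col b" "row a < row b"
    have perm: "p permutes {1..k}" by (rule columns_permutes[OF p])
    have pab: "p a \<in> {1..k}" "p b \<in> {1..k}" "col (p a) = col (p b)"
      using ab permutes_in_image[OF perm] columns_col[OF p] by auto
    have "\<not> x (p b) < x (p a)"
    proof
      assume "x (p b) < x (p a)"
      then have "row_sum (x \<circ> p) < row_sum (x \<circ> p \<circ> Transposition.transpose a b)"
        using ab by (intro row_sum_transpose) auto
      moreover have "p \<circ> Transposition.transpose a b \<in> columns"
        by (intro columns_compose p transpose_in_columns ab)
      ultimately show False
        using max[of "p \<circ> Transposition.transpose a b"] by (simp add: comp_assoc)
    qed
    moreover have "p a \<noteq> p b"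
      using ab permutes_inj[OF perm] by (auto dest: injD)
    then have "x (p a) \<noteq> x (p b)"
      using inj[OF pab] by blast
    ultimately have "x (p a) < x (p b)" by simp
    moreover have "x (p b) < x (p a)" if "row (p b) < row (p a)"
      using x pab(1,2) pab(3)[symmetric] that unfolding column_strict_def by blast
    ultimately show "row (p a) < row (p b)"
      using pab cell_cases[OF pab(1,2) \<open>p a \<noteq> p b\<close>] by linarith
  qed
  let ?f = "\<lambda>r. row_sum (x \<circ> r)"
  have "Max (?f ` columns) \<in> ?f ` columns"
    using finite_columns id_in_columns by (intro Max_in) auto
  then obtain q where q: "q \<in> columns" "?f q = Max (?f ` columns)"
    unfolding image_iff by metis
  have le: "?f r \<le> ?f q" if "r \<in> columns" for r
    unfolding q(2) using finite_columns that by (intro Max_ge) auto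
  \<comment> \<open>The maximiser \<open>q\<close> is the identity, so the maximum is
    \<open>row_sum x\<close>. By \<open>max_id\<close> again, any other column permutation stays
    strictly below it.\<close>
  have "q = id" by (rule max_id[OF q(1) le])
  then have le_id: "?f r \<le> row_sum x" if "r \<in> columns" for r
    using le[OF that] by simp
  show ?thesis
  proof (cases "row_sum (x \<circ> p) = row_sum x")
    case True
    then show ?thesis using max_id[OF p] le_id by auto
  next
    case False
    then show ?thesis using le_id[OF p] by simp
  qed
qed

section \<open>Row contents of a filling\<close>

text \<open>This keeps one multiset per row, unlike the usual content of a tableau, which is the
  multiset of all its entries.\<close>

definition content :: "(nat \<Rightarrow> nat) \<Rightarrow> nat multiset list" where
  "content x = map (\<lambda>i. image_mset x (mset_set (row_set i))) [0..<length lam]"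

lemma row_in_range: "m \<in> {1..k} \<Longrightarrow> row m < length lam"
  using cell_in_diagram by (fastforce simp: diagram_def)

text \<open>The weight depends only on the multisets of the rows, so it orders the basis vectors
  \<open>basis_vec (content x)\<close> and leading terms make sense.\<close>

lemma row_sum_content: "row_sum x = (\<Sum>i<length lam. i * sum_mset (content x ! i))"
proof -
  have "row_sum x = (\<Sum>i<length lam. \<Sum>m | m \<in> {1..k} \<and> row m = i. row m * x m)"
    unfolding row_sum_def using row_in_range
    by (intro sum.group[symmetric]) auto
  also have "\<dots> = (\<Sum>i<length lam. i * (\<Sum>m\<in>row_set i. x m))"
    by (auto simp: row_set_def sum_distrib_left intro!: sum.cong)
  finally show ?thesis
    by (simp add: content_def sum_unfold_sum_mset)
qed

lemma row_set_eq_image: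
  assumes "i < length lam"
  shows "row_set i = (\<lambda>j. t (i, j)) ` {0..<lam ! i}" "inj_on (\<lambda>j. t (i, j)) {0..<lam ! i}"
proof -
  have "{c \<in> diagram lam. fst c = i} = Pair i ` {0..<lam ! i}"
    using assms by (auto simp: diagram_def)
  then show "row_set i = (\<lambda>j. t (i, j)) ` {0..<lam ! i}"
    unfolding image_row[symmetric] by (simp add: image_image)
  show "inj_on (\<lambda>j. t (i, j)) {0..<lam ! i}"
  proof
    fix j j' assume "j \<in> {0..<lam ! i}" "j' \<in> {0..<lam ! i}" "t (i, j) = t (i, j')"
    moreover from this assms have "(i, j) \<in> diagram lam" "(i, j') \<in> diagram lam"
      by (auto simp: diagram_def)
    ultimately have "(i, j) = (i, j')" using cell_t by metis
    then show "j = j'" by simp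
  qed
qed

text \<open>Each row, read from left to right, is a sorted list, and a sorted list is determined by
  its multiset.\<close>

lemma content_eqD:
  assumes "row_weak x" "row_weak y" "content x = content y" "m \<in> {1..k}"
  shows "x m = y m"
proof -
  define i where "i = row m"
  have i: "i < length lam" unfolding i_def by (rule row_in_range[OF assms(4)])
  define l where "l z = map (\<lambda>j. z (t (i, j))) [0..<lam ! i]" for z :: "nat \<Rightarrow> nat"
  have mset_l: "mset (l z) = image_mset z (mset_set (row_set i))" for z
    unfolding l_def row_set_eq_image(1)[OF i]
      image_mset_mset_set[OF row_set_eq_image(2)[OF i], symmetric]
    by (simp add: multiset.map_comp comp_def)
  have "content x ! i = content y ! i" using assms(3) by simp
  then have "mset (l x) = mset (l y)" using i by (simp add: content_def mset_l)
  moreover have "sorted (l z)" if "row_weak z" for z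
  proof -
    have "z (t (i, j)) \<le> z (t (i, j'))" if jj: "j \<le> j'" "j' < lam ! i" for j j'
    proof (cases "j = j'")
      case False
      have d: "(i, j) \<in> diagram lam" "(i, j') \<in> diagram lam"
        using jj i by (auto simp: diagram_def)
      show ?thesis
        using \<open>row_weak z\<close> t_in[OF d(1)] t_in[OF d(2)] cell_t[OF d(1)] cell_t[OF d(2)] jj False
        unfolding row_weak_def by (metis fst_conv snd_conv le_neq_implies_less)
    qed simp
    then show ?thesis by (auto simp: l_def sorted_iff_nth_mono)
  qed
  ultimately have "l x = l y"
    using assms(1,2) properties_for_sort by metis
  moreover have "cell m \<in> diagram lam" by (rule cell_in_diagram[OF assms(4)])
  then have "col m < lam ! i" by (auto simp: diagram_def i_def split: prod.splits)
  ultimately have "l x ! col m = l y ! col m" "col m < lam ! i" by simp_all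
  then have "x (t (row m, col m)) = y (t (row m, col m))"
    by (simp add: l_def i_def)
  then show ?thesis using t_cell[OF assms(4)] by simp
qed

section \<open>Garnir relations\<close>

text \<open>Together with \<open>upper_part\<close> in a column further right, this forms the Garnir
  set attached to row \<open>i\<close>; both parts include row \<open>i\<close>.\<close>

definition lower_part :: "nat \<Rightarrow> nat \<Rightarrow> nat set" where
  "lower_part i j = {m \<in> {1..k}. col m = j \<and> i \<le> row m}"

definition upper_part :: "nat \<Rightarrow> nat \<Rightarrow> nat set" where
  "upper_part i j = {m \<in> {1..k}. col m = j \<and> row m \<le> i}"

text \<open>The two parts together have one cell more than column \<open>j\<close> and lie in rows meeting
  column \<open>j\<close>, so any column permutation puts two of their cells in the same row.\<close>

lemma same_row_in_parts:
  assumes "p \<in> columns" "j < j'" "(i, j') \<in> diagram lam"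
  obtains a b where "a \<in> {1..k}" "b \<in> {1..k}" "a \<noteq> b" "row a = row b"
    "p a \<in> lower_part i j" "p b \<in> upper_part i j'"
proof -
  define H where "H = {i. (i, j) \<in> diagram lam}"
  have finH: "finite H"
    by (rule finite_subset[of _ "{..<length lam}"]) (auto simp: H_def diagram_def)
  have p: "p permutes {1..k}" by (rule columns_permutes[OF assms(1)])
  \<comment> \<open>Since \<open>p\<close> preserves columns, the preimages \<open>L\<close> and
    \<open>U\<close> lie in the columns \<open>j\<close> and \<open>j'\<close>, and they are as
    large as the two parts.\<close>
  define L where "L = {m. p m \<in> lower_part i j}"
  define U where "U = {m. p m \<in> upper_part i j'}"
  have p_in: "p m \<in> {1..k} \<longleftrightarrow> m \<in> {1..k}" for m by (rule permutes_in_image[OF p])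
  have L: "m \<in> {1..k}" "col m = j" if "m \<in> L" for m
  proof -
    have "p m \<in> {1..k}" "col (p m) = j" using that by (auto simp: L_def lower_part_def)
    then show "m \<in> {1..k}" "col m = j" using p_in[of m] columns_col[OF assms(1), of m] by auto
  qed
  have U: "m \<in> {1..k}" "col m = j'" if "m \<in> U" for m
  proof -
    have "p m \<in> {1..k}" "col (p m) = j'" using that by (auto simp: U_def upper_part_def)
    then show "m \<in> {1..k}" "col m = j'" using p_in[of m] columns_col[OF assms(1), of m] by auto
  qed
  have card_pre: "card {m. p m \<in> M} = card M" for M
  proof -
    have "p ` {m. p m \<in> M} = M" 
      using surj_image_vimage_eq[OF permutes_surj[OF p], of M] by (simp add: vimage_def)
    then show ?thesis
      using card_image[of p "{m. p m \<in> M}"] permutes_inj[OF p] by (metis inj_on_subset subset_UNIV)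
  qed
  have inj_row: "inj_on (\<lambda>m. row m) M" if "M \<subseteq> {1..k}" "\<And>m. m \<in> M \<Longrightarrow> col m = c" for M c
  proof
    fix a b assume ab: "a \<in> M" "b \<in> M" "row a = row b"
    show "a = b"
      by (rule cell_eqI) (use ab that in \<open>auto simp only: subset_iff\<close>)
  qed
  have diag: "(r, c) \<in> diagram lam \<longleftrightarrow> (\<exists>m\<in>{1..k}. row m = r \<and> col m = c)" for r c
    using cell_exists[of r c] cell_in_diagram by (metis prod.collapse)
  have rows_lower: "row ` lower_part i j = {r \<in> H. i \<le> r}"
    by (auto simp: H_def diag lower_part_def)
  have rows_upper: "row ` upper_part i j' = {..i}"
    using diagram_downward_closed[OF partition assms(3), of _ j']
    by (force simp: diag upper_part_def)
  have sub: "{..i} \<subseteq> H"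
    using diagram_downward_closed[OF partition assms(3), of _ j] assms(2) by (auto simp: H_def)
  have "card (row ` L) = card L"
    by (rule card_image[OF inj_row]) (use L in auto)
  also have "\<dots> = card (lower_part i j)" by (simp add: L_def card_pre)
  also have "\<dots> = card (row ` lower_part i j)"
    by (rule card_image[OF inj_row, symmetric]) (auto simp: lower_part_def)
  finally have cL: "card (row ` L) = card {r \<in> H. i \<le> r}" by (simp add: rows_lower)
  have "card (row ` U) = card U"
    by (rule card_image[OF inj_row]) (use U in auto)
  also have "\<dots> = card (upper_part i j')" by (simp add: U_def card_pre)
  also have "\<dots> = card (row ` upper_part i j')"
    by (rule card_image[OF inj_row, symmetric]) (auto simp: upper_part_def)
  finally have cU: "card (row ` U) = card {..i}" by (simp add: rows_upper)
  \<comment> \<open>The rows of the two parts cover \<open>H\<close> and overlap exactly in row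
    \<open>i\<close>. This overlap is the surplus 1 that drives the pigeonhole argument.\<close>
  have "card {r \<in> H. i \<le> r} + card {..i} = card ({r \<in> H. i \<le> r} \<union> {..i}) + card ({r \<in> H. i \<le> r} \<inter> {..i})"
    using finH by (intro card_Un_Int) auto
  moreover have "{r \<in> H. i \<le> r} \<union> {..i} = H" "{r \<in> H. i \<le> r} \<inter> {..i} = {i}"
    using sub by auto
  ultimately have gt: "card (row ` L) + card (row ` U) = card H + 1"
    by (simp add: cL cU)
  have "row ` L \<subseteq> H"
    using L by (auto simp: H_def diag)
  moreover have "row ` U \<subseteq> H"
  proof
    fix r assume "r \<in> row ` U"
    then have "(r, j') \<in> diagram lam" using U by (auto simp: diag)
    then show "r \<in> H"
      using diagram_downward_closed[OF partition _ order_refl, of r j' j] assms(2) by (simp add: H_def)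
  qed
  ultimately have "row ` L \<inter> row ` U \<noteq> {}"
  proof (intro notI)
    assume LU: "row ` L \<subseteq> H" "row ` U \<subseteq> H" "row ` L \<inter> row ` U = {}"
    then have "card (row ` L \<union> row ` U) = card (row ` L) + card (row ` U)"
      using finH by (intro card_Un_disjoint) (auto intro: finite_subset)
    moreover have "card (row ` L \<union> row ` U) \<le> card H"
      using LU finH by (intro card_mono) auto
    ultimately show False using gt by simp
  qed
  then obtain a b where ab: "a \<in> L" "b \<in> U" "row a = row b" by blast
  have "a \<noteq> b" using L(2)[OF ab(1)] U(2)[OF ab(2)] assms(2) by auto
  then show ?thesis
    using that[of a b] L(1)[OF ab(1)] U(1)[OF ab(2)] ab by (auto simp: L_def U_def)
qed

definition tabloid_of :: "(nat \<Rightarrow> nat) \<Rightarrow> nat set list" where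
  "tabloid_of p = map (\<lambda>i. p ` row_set i) [0..<length lam]"

lemma tabloid_comp: "tabloid lam (p \<circ> t) = tabloid_of p"
  unfolding tabloid_def tabloid_of_def image_comp[symmetric] image_row by (rule refl)

lemma tabloid_of_transpose:
  assumes "a \<in> {1..k}" "b \<in> {1..k}" "row a = row b"
  shows "tabloid_of (p \<circ> Transposition.transpose a b) = tabloid_of p"
proof -
  have "Transposition.transpose a b ` row_set i = row_set i" for i
  proof (cases "i = row a")
    case True
    then have "a \<in> row_set i" "b \<in> row_set i" using assms by (auto simp: row_set_def)
    then show ?thesis by simp
  next
    case False
    then have "a \<notin> row_set i" "b \<notin> row_set i" using assms by (auto simp: row_set_def)
    then show ?thesis by simp
  qed
  then show ?thesis unfolding tabloid_of_def image_comp[symmetric] by (simp only:)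
qed

abbreviation sgn_perm :: "(nat \<Rightarrow> nat) \<Rightarrow> complex" where
  "sgn_perm p \<equiv> of_int (sign p)"

lemma sgn_perm_compose:
  assumes "finite S" "finite S'" "p permutes S" "q permutes S'"
  shows "sgn_perm (p \<circ> q) = sgn_perm p * sgn_perm q"
proof -
  have "permutation p" "permutation q"
    using assms unfolding permutation_permutes by blast+
  then show ?thesis by (simp add: sign_compose)
qed

lemma polytabloid_eq:
  "polytabloid k lam t = (\<Sum>p\<in>columns. cscale (sgn_perm p) (basis_vec (tabloid_of p)))"
  unfolding polytabloid_def column_stabilizer_eq tabloid_comp by (rule refl)

abbreviation garnir_set :: "nat \<Rightarrow> nat \<Rightarrow> nat \<Rightarrow> nat set" where
  "garnir_set i j j' \<equiv> lower_part i j \<union> upper_part i j'"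

lemma finite_parts [simp]: "finite (lower_part i j)" "finite (upper_part i j)"
  by (auto simp: lower_part_def upper_part_def)

text \<open>For each single \<open>p\<close> the sum over \<open>s\<close> already vanishes, by a
  sign-reversing involution that exchanges the two entries provided by
  \<open>same_row_in_parts\<close>. All permutations of the Garnir set are summed, so that no coset
  representatives have to be chosen.\<close>

lemma garnir_relation:
  assumes "j < j'" "(i, j') \<in> diagram lam"
  shows "(\<Sum>s | s permutes garnir_set i j j'. cscale (sgn_perm s)
    (\<Sum>p\<in>columns. cscale (sgn_perm p) (basis_vec (tabloid_of (s \<circ> p))))) = 0"
proof -
  let ?P = "{s. s permutes garnir_set i j j'}"
  have *: "(\<Sum>s\<in>?P. cscale (sgn_perm s) (basis_vec (tabloid_of (s \<circ> p)))) = 0" (is "?X = 0")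
    if p: "p \<in> columns" for p
  proof -
    obtain a b where ab: "a \<in> {1..k}" "b \<in> {1..k}" "a \<noteq> b" "row a = row b"
      "p a \<in> lower_part i j" "p b \<in> upper_part i j'"
      using same_row_in_parts[OF p assms] by blast
    have inj: "inj p" by (rule permutes_inj[OF columns_permutes[OF p]])
    define u where "u = Transposition.transpose (p a) (p b)"
    have u: "u permutes garnir_set i j j'"
      unfolding u_def using ab by (intro permutes_swap_id) auto
    \<comment> \<open>Multiplication by \<open>u\<close> flips the sign, but it only exchanges two entries of one row of the
      tabloid of \<open>s \<circ> p\<close>, so the summands cancel in pairs.\<close>
    have sgn_u: "sgn_perm (s \<circ> u) = - sgn_perm s" if "s \<in> ?P" for s
    proof -
      have "p a \<noteq> p b" using ab(3) inj by (auto dest: injD)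
      then have "sign u = - 1" by (simp add: u_def sign_swap_id)
      then show ?thesis using that u 
        sgn_perm_compose[of "garnir_set i j j'" "garnir_set i j j'" s u] by simp
    qed
    have "u \<circ> p = p \<circ> Transposition.transpose a b"
      using inj by (auto simp: u_def fun_eq_iff transpose_def dest: injD)
    then have tab_u: "tabloid_of (s \<circ> u \<circ> p) = tabloid_of (s \<circ> p)" for s
      using tabloid_of_transpose[OF ab(1,2,4), of "s \<circ> p"] by (simp add: comp_assoc)
    have uu: "u \<circ> u = id" by (simp add: u_def)
    have "?X = (\<Sum>s\<in>?P. cscale (sgn_perm (s \<circ> u)) (basis_vec (tabloid_of (s \<circ> u \<circ> p))))"
      by (rule sum.reindex_bij_witness[of _ "\<lambda>s. s \<circ> u" "\<lambda>s. s \<circ> u"])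
        (auto simp: comp_assoc uu permutes_compose u)
    also have "\<dots> = (\<Sum>s\<in>?P. - cscale (sgn_perm s) (basis_vec (tabloid_of (s \<circ> p))))"
      by (rule sum.cong) (simp_all only: sgn_u tab_u free.scale_minus_left)
    also have "\<dots> = - ?X" by (rule sum_negf)
    finally have eq: "?X = - ?X" .
    show ?thesis
    proof (rule poly_mapping_eqI)
      fix T
      have "poly_mapping.lookup ?X T = - poly_mapping.lookup ?X T"
        by (subst eq) (rule lookup_uminus)
      then show "poly_mapping.lookup ?X T = poly_mapping.lookup 0 T" by simp
    qed
  qed
  have "(\<Sum>s\<in>?P. cscale (sgn_perm s)
      (\<Sum>p\<in>columns. cscale (sgn_perm p) (basis_vec (tabloid_of (s \<circ> p)))))
    = (\<Sum>p\<in>columns. cscale (sgn_perm p)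
      (\<Sum>s\<in>?P. cscale (sgn_perm s) (basis_vec (tabloid_of (s \<circ> p)))))"
    unfolding free.scale_sum_right by (subst sum.swap) (simp only: free.scale_left_commute)
  also have "\<dots> = 0" using * by (intro sum.neutral) simp
  finally show ?thesis .
qed

text \<open>By injectivity \<open>s\<close> also stabilizes the rest of the Garnir set, which is the
  lower part; elsewhere it is the identity. Such \<open>s\<close> only reproduce the original
  filling up to sign in a Garnir sum.\<close>

lemma parts_stable:
  assumes s: "s permutes garnir_set i j j'" and "j \<noteq> j'"
    and stable: "s ` upper_part i j' = upper_part i j'"
  shows "s \<in> columns"
proof -
  have disj: "lower_part i j \<inter> upper_part i j' = {}"
    using assms(2) by (auto simp: lower_part_def upper_part_def)
  have perm: "s permutes {1..k}"
    by (rule permutes_subset[OF s]) (auto simp: lower_part_def upper_part_def)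
  have "s ` (garnir_set i j j' - upper_part i j') = garnir_set i j j' - upper_part i j'"
    unfolding image_set_diff[OF permutes_inj[OF s]] stable permutes_image[OF s] by (rule refl)
  then have lower: "s ` lower_part i j = lower_part i j"
    using disj by (simp add: Un_Diff Diff_triv)
  have "col (s m) = col m" for m
  proof -
    consider "m \<in> lower_part i j" | "m \<in> upper_part i j'" | "m \<notin> garnir_set i j j'" by blast
    then show ?thesis
    proof cases
      case 1
      then have "s m \<in> lower_part i j" using lower by blast
      then show ?thesis using 1 by (simp add: lower_part_def)
    next
      case 2
      then have "s m \<in> upper_part i j'" using stable by blast
      then show ?thesis using 2 by (simp add: upper_part_def)
    next
      case 3
      show ?thesis using permutes_not_in[OF s 3] by simp
    qed
  qed
  then show ?thesis using perm by (simp add: columns_def)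
qed

text \<open>Some entries of the upper part, all at most \<open>v\<close>, are exchanged for equally
  many entries of the lower part, all above \<open>v\<close>. Larger entries thus move into the
  column with the larger weight.\<close>

lemma col_sum_garnir:
  assumes s: "s permutes garnir_set i j j'" and "j < j'"
    and unstable: "s ` upper_part i j' \<noteq> upper_part i j'"
    and x: "\<And>a b. a \<in> lower_part i j \<Longrightarrow> b \<in> upper_part i j' \<Longrightarrow> x b \<le> v \<and> v < x a"
  shows "col_sum x < col_sum (x \<circ> s)"
proof -
  let ?L = "lower_part i j" and ?U = "upper_part i j'"
  obtain d where d: "j' = j + d" "d > 0"
    using assms(2) less_imp_add_positive by metis
  have disj: "?L \<inter> ?U = {}"
    using assms(2) by (auto simp: lower_part_def upper_part_def)
  have sub: "garnir_set i j j' \<subseteq> {1..k}" by (auto simp: lower_part_def upper_part_def)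
  \<comment> \<open>With the weight of column \<open>j'\<close> written as \<open>j + d\<close>, the
    first two terms are invariant under \<open>s\<close>, so only the sum over the upper part
    matters.\<close>
  have split: "col_sum y = (\<Sum>m\<in>{1..k} - garnir_set i j j'. col m * y m)
      + j * (\<Sum>m\<in>garnir_set i j j'. y m) + d * (\<Sum>m\<in>?U. y m)" for y
  proof -
    have "col_sum y = (\<Sum>m\<in>{1..k} - garnir_set i j j'. col m * y m) + (\<Sum>m\<in>garnir_set i j j'. col m * y m)"
      unfolding col_sum_def using sub by (intro sum.subset_diff) auto
    moreover have "(\<Sum>m\<in>garnir_set i j j'. col m * y m) = (\<Sum>m\<in>?L. col m * y m) + (\<Sum>m\<in>?U. col m * y m)"
      using disj by (intro sum.union_disjoint) auto
    moreover have "(\<Sum>m\<in>?L. col m * y m) = j * (\<Sum>m\<in>?L. y m)"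
      unfolding sum_distrib_left by (rule sum.cong) (auto simp: lower_part_def)
    moreover have "(\<Sum>m\<in>?U. col m * y m) = (j + d) * (\<Sum>m\<in>?U. y m)"
      unfolding sum_distrib_left by (rule sum.cong) (auto simp: upper_part_def d)
    moreover have "(\<Sum>m\<in>garnir_set i j j'. y m) = (\<Sum>m\<in>?L. y m) + (\<Sum>m\<in>?U. y m)"
      using disj by (intro sum.union_disjoint) auto
    ultimately show ?thesis by (simp only:) (simp add: algebra_simps)
  qed
  have "(\<Sum>m\<in>{1..k} - garnir_set i j j'. col m * (x \<circ> s) m)
      = (\<Sum>m\<in>{1..k} - garnir_set i j j'. col m * x m)"
    by (rule sum.cong) (auto simp: permutes_not_in[OF s])
  moreover have "(\<Sum>m\<in>garnir_set i j j'. (x \<circ> s) m) = (\<Sum>m\<in>garnir_set i j j'. x m)"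
    by (rule sum.permute[OF s, symmetric])
  moreover have "(\<Sum>m\<in>?U. x m) < (\<Sum>m\<in>?U. (x \<circ> s) m)"
  proof -
    \<comment> \<open>On the upper part, \<open>x \<circ> s\<close> reads the entries of
      \<open>x\<close> at \<open>D\<close>. Compared with \<open>x\<close>, those at
      \<open>?U - D\<close> are replaced by those at \<open>D - ?U\<close>.\<close>
    define D where "D = s ` ?U"
    have fin: "finite D" by (simp add: D_def)
    have inj: "inj_on s ?U" by (rule inj_on_subset[OF permutes_inj[OF s]]) simp
    have cardD: "card D = card ?U" unfolding D_def by (rule card_image[OF inj])
    have DS: "D \<subseteq> garnir_set i j j'"
      unfolding D_def using permutes_image[OF s] by blast
    have card_eq: "card (D - ?U) = card (?U - D)"
      using cardD fin card_Diff_subset_Int[of D ?U] card_Diff_subset_Int[of ?U D]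
      by (simp add: Int_commute)
    have "\<not> D \<subseteq> ?U"
      using unstable card_subset_eq[of ?U D] cardD by (auto simp: D_def)
    then have pos: "card (D - ?U) > 0" using fin by (simp add: card_gt_0_iff)
    obtain a where a: "a \<in> D - ?U" using \<open>\<not> D \<subseteq> ?U\<close> by blast
    then have aL: "a \<in> ?L" using DS by blast
    have "(\<Sum>m\<in>?U - D. x m) \<le> card (?U - D) * v"
      using sum_bounded_above[of "?U - D" x v] x[OF aL] by simp
    also have "\<dots> < card (D - ?U) * Suc v" using pos card_eq by simp
    also have "\<dots> \<le> (\<Sum>m\<in>D - ?U. x m)"
    proof -
      \<comment> \<open>The bounds in \<open>x\<close> are stated for pairs, so an element of the
        upper part is needed to apply them to the lower part.\<close>
      obtain b where "b \<in> ?U - D" using pos card_eq by (metis card_gt_0_iff ex_in_conv)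
      then show ?thesis
        using sum_bounded_below[of "D - ?U" "Suc v" x] x DS by fastforce
    qed
    finally have "(\<Sum>m\<in>?U - D. x m) < (\<Sum>m\<in>D - ?U. x m)" .
    moreover have "(\<Sum>m\<in>?U. x m) = (\<Sum>m\<in>?U - D. x m) + (\<Sum>m\<in>?U \<inter> D. x m)"
      using sum.Int_Diff[of ?U x D] by simp
    moreover have "(\<Sum>m\<in>D. x m) = (\<Sum>m\<in>D - ?U. x m) + (\<Sum>m\<in>?U \<inter> D. x m)"
      using sum.Int_Diff[OF fin, of x ?U] by (simp add: Int_commute)
    moreover have "(\<Sum>m\<in>?U. (x \<circ> s) m) = (\<Sum>m\<in>D. x m)"
      unfolding D_def by (rule sum.reindex[OF inj, symmetric])
    ultimately show ?thesis by simp
  qed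
  ultimately show ?thesis
    using d by (simp only: split[of x] split[of "x \<circ> s"]) simp
qed

section \<open>Straightening and leading terms\<close>

text \<open>The proof is by induction on the pair of \<open>col_sum\<close> and
  \<open>row_sum\<close>, ordered lexicographically with larger values treated first.
  \<open>E\<close> and \<open>N\<close> are kept abstract: only the column and Garnir relations
  modulo \<open>N\<close> enter.\<close>

lemma straightening:
  fixes E :: "(nat \<Rightarrow> nat) \<Rightarrow> ('x \<Rightarrow>\<^sub>0 complex)"
  assumes N: "free.subspace N"
    and column: "\<And>x p. x ` {1..k} \<subseteq> {1..n} \<Longrightarrow> p \<in> columns
      \<Longrightarrow> E (x \<circ> p) - cscale (sgn_perm p) (E x) \<in> N"
    and garnir: "\<And>x i j j'. x ` {1..k} \<subseteq> {1..n} \<Longrightarrow> j < j' \<Longrightarrow> (i, j') \<in> diagram lam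
      \<Longrightarrow> (\<Sum>s | s permutes garnir_set i j j'. cscale (sgn_perm s) (E (x \<circ> s))) \<in> N"
    and semistandard: "\<And>x. x ` {1..k} \<subseteq> {1..n} \<Longrightarrow> column_strict x \<Longrightarrow> row_weak x \<Longrightarrow> E x \<in> N"
    and x: "x ` {1..k} \<subseteq> {1..n}"
  shows "E x \<in> N"
proof -
  \<comment> \<open>These are the weights of the filling with all entries \<open>n\<close>.
    Subtracting from them turns growing weights into decreasing measures.\<close>
  define R where "R = (\<Sum>m\<in>{1..k}. row m * n)"
  define C where "C = (\<Sum>m\<in>{1..k}. col m * n)"
  have bound: "row_sum x \<le> R" "col_sum x \<le> C" if "x ` {1..k} \<subseteq> {1..n}" for x
    unfolding R_def C_def row_sum_def col_sum_def using that by (auto intro!: sum_mono mult_le_mono2)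
  have scale_iff: "cscale c v \<in> N \<longleftrightarrow> v \<in> N" if "c \<noteq> 0" for c v
  proof
    assume "cscale c v \<in> N"
    then have "cscale (inverse c) (cscale c v) \<in> N" by (rule free.subspace_scale[OF N])
    then show "v \<in> N" using that by simp
  qed (rule free.subspace_scale[OF N])
  have range_perm: "(x \<circ> p) ` {1..k} \<subseteq> {1..n}" if "x ` {1..k} \<subseteq> {1..n}" "p permutes {1..k}" for x p
    unfolding image_comp[symmetric] permutes_image[OF that(2)] by (rule that(1))
  show ?thesis using x
  proof (induction x rule: wf_induct_rule[OF wf_measures[of "[\<lambda>x. C - col_sum x, \<lambda>x. R - row_sum x]"]])
    case (1 x)
    have IH: "E y \<in> N" if "y ` {1..k} \<subseteq> {1..n}"
      "col_sum x < col_sum y \<or> col_sum x = col_sum y \<and> row_sum x < row_sum y" for y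
    proof (rule 1(1)[OF _ that(1)])
      have "C - col_sum y < C - col_sum x \<or> C - col_sum y = C - col_sum x \<and> R - row_sum y < R - row_sum x"
        using that(2) bound[OF that(1)] by linarith
      then show "(y, x) \<in> measures [\<lambda>x. C - col_sum x, \<lambda>x. R - row_sum x]" by simp
    qed
    show ?case
    proof (cases "column_strict x")
      case False
      then obtain a b where ab: "a \<in> {1..k}" "b \<in> {1..k}" "col a = col b" "row a < row b" "x b \<le> x a"
        unfolding column_strict_def using linorder_not_less by blast
      \<comment> \<open>Modulo \<open>N\<close>, exchanging \<open>a\<close> and \<open>b\<close>
        negates \<open>E x\<close>. If the entries are equal, \<open>N\<close> contains twice
        \<open>E x\<close>; otherwise the exchange keeps \<open>col_sum\<close> and raises
        \<open>row_sum\<close>, so induction applies.\<close>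
      define u where "u = Transposition.transpose a b"
      have u: "u \<in> columns" unfolding u_def by (rule transpose_in_columns[OF ab(1-3)])
      have "a \<noteq> b" using ab(4) by auto
      then have "sgn_perm u = - 1" by (simp add: u_def sign_swap_id)
      then have sum_in: "E (x \<circ> u) + E x \<in> N"
        using column[OF 1(2) u] by simp
      show ?thesis
      proof (cases "x b = x a")
        case True
        then have "x \<circ> u = x" by (auto simp: u_def fun_eq_iff transpose_def)
        then have "cscale 2 (E x) \<in> N"
          using sum_in free.scale_left_distrib[of 1 1 "E x"] by simp
        then show ?thesis by (simp add: scale_iff)
      next
        case False
        then have "row_sum x < row_sum (x \<circ> u)"
          unfolding u_def using ab by (intro row_sum_transpose) auto
        then have "E (x \<circ> u) \<in> N"
          using col_sum_columns[OF u, of x] range_perm[OF 1(2) columns_permutes[OF u]]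
          by (intro IH) auto
        then show ?thesis
          using free.subspace_diff[OF N sum_in, of "E (x \<circ> u)"] by simp
      qed
    next
      case strict: True
      show ?thesis
      proof (cases "row_weak x")
        case True
        then show ?thesis using semistandard[OF 1(2) strict] by blast
      next
        case False
        then obtain a b where ab: "a \<in> {1..k}" "b \<in> {1..k}" "row a = row b" "col a < col b" "x b < x a"
          unfolding row_weak_def using linorder_not_less by blast
        \<comment> \<open>The Garnir set is taken at the descent: from \<open>a\<close> down its
          column and from the top down to \<open>b\<close>. As the columns increase strictly, its
          lower entries are at least \<open>x a\<close> and its upper ones at most
          \<open>x b\<close>, so \<open>x b\<close> separates them.\<close>
        define i j j' where "i = row a" "j = col a" "j' = col b"
        note ij_defs = this
        have jj: "j < j'" using ab(4) by (simp add: ij_defs)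
        have ij: "(i, j') \<in> diagram lam"
          using cell_in_diagram[OF ab(2)] ab(3) by (simp add: ij_defs)
        let ?P = "{s. s permutes garnir_set i j j'}"
        let ?stable = "\<lambda>s. s ` upper_part i j' = upper_part i j'"
        have finP: "finite ?P" by (simp add: finite_permutations)
        have perm: "s permutes {1..k}" if "s \<in> ?P" for s
          by (rule permutes_subset[of s "garnir_set i j j'"])
            (use that in \<open>auto simp: lower_part_def upper_part_def\<close>)
        have entries: "x d \<le> x b \<and> x b < x c" if "c \<in> lower_part i j" "d \<in> upper_part i j'" for c d
        proof -
          have c: "c \<in> {1..k}" "col c = col a" "row a \<le> row c"
            using that(1) by (auto simp: lower_part_def ij_defs)
          have d: "d \<in> {1..k}" "col d = col b" "row d \<le> row b"
            using that(2) ab(3) by (auto simp: upper_part_def ij_defs)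
          have "x a \<le> x c"
          proof (cases "row a = row c")
            case True
            then have "a = c" by (rule cell_eqI[OF ab(1) c(1) _ c(2)[symmetric]])
            then show ?thesis by simp
          next
            case False
            then show ?thesis using strict c ab(1) unfolding column_strict_def
              by (metis le_neq_implies_less less_imp_le)
          qed
          moreover have "x d \<le> x b"
          proof (cases "row d = row b")
            case True
            then have "d = b" by (rule cell_eqI[OF d(1) ab(2) _ d(2)])
            then show ?thesis by simp
          next
            case False
            then show ?thesis using strict d ab(2) unfolding column_strict_def
              by (metis le_neq_implies_less less_imp_le)
          qed
          ultimately show ?thesis using ab(5) by simp
        qed
        \<comment> \<open>Each term of the Garnir sum is evaluated modulo \<open>N\<close>. A stable
          \<open>s\<close> is a column permutation, whose two signs cancel and leave
          \<open>E x\<close>; an unstable \<open>s\<close> raises \<open>col_sum\<close>, so its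
          term is in \<open>N\<close> by induction.\<close>
        have "cscale (sgn_perm s) (E (x \<circ> s)) - (if ?stable s then E x else 0) \<in> N"
          if s: "s \<in> ?P" for s
        proof (cases "?stable s")
          case True
          have "s \<in> columns" by (rule parts_stable[OF _ _ True]) (use s jj in auto)
          then have "cscale (sgn_perm s) (E (x \<circ> s) - cscale (sgn_perm s) (E x)) \<in> N"
            by (intro free.subspace_scale[OF N] column 1)
          moreover have "sgn_perm s * sgn_perm s = 1"
            by (simp add: sign_idempotent flip: of_int_mult)
          ultimately show ?thesis
            using True by (simp add: free.scale_right_diff_distrib)
        next
          case False
          have "col_sum x < col_sum (x \<circ> s)"
            by (rule col_sum_garnir[OF _ jj False entries]) (use s in auto)
          then have "E (x \<circ> s) \<in> N"
            using range_perm[OF 1(2) perm[OF s]] by (intro IH) auto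
          then show ?thesis using False by (simp add: free.subspace_scale[OF N])
        qed
        then have "(\<Sum>s\<in>?P. cscale (sgn_perm s) (E (x \<circ> s)) - (if ?stable s then E x else 0)) \<in> N"
          by (rule free.subspace_sum[OF N])
        then have "(\<Sum>s\<in>?P. cscale (sgn_perm s) (E (x \<circ> s)))
            - (\<Sum>s\<in>?P. cscale (sgn_perm s) (E (x \<circ> s)) - (if ?stable s then E x else 0)) \<in> N"
          by (rule free.subspace_diff[OF N garnir[OF 1(2) jj ij]])
        then have "(\<Sum>s\<in>?P. if ?stable s then E x else 0) \<in> N"
          by (simp add: sum_subtractf)
        also have "(\<Sum>s\<in>?P. if ?stable s then E x else 0) = (\<Sum>s\<in>{s\<in>?P. ?stable s}. E x)"
          by (rule sum.inter_filter[OF finP, symmetric])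
        also have "\<dots> = cscale (of_nat (card {s\<in>?P. ?stable s})) (E x)"
          by (simp add: free.sum_constant_scale)
        finally have in_N: "cscale (of_nat (card {s\<in>?P. ?stable s})) (E x) \<in> N" .
        \<comment> \<open>The identity is stable, so the multiplicity of \<open>E x\<close> is a
          nonzero complex number and can be divided out.\<close>
        have "id \<in> {s\<in>?P. ?stable s}" by (simp add: permutes_id)
        then have "card {s\<in>?P. ?stable s} \<noteq> 0"
          using finP card_gt_0_iff by (metis (no_types, lifting) empty_iff finite_subset
              less_irrefl mem_Collect_eq subsetI)
        then show ?thesis using in_N by (simp only: scale_iff of_nat_eq_0_iff not_False_eq_True)
      qed
    qed
  qed
qed

text \<open>Among the indices with nonzero coefficient, choose \<open>j\<close> with maximal
  \<open>row_sum (x j)\<close>; the basis vector of \<open>content (x j)\<close> then occurs only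
  once in the whole sum.\<close>

lemma polytabloid_coefficients_independent:
  assumes I: "finite I"
    and ss: "\<And>i. i \<in> I \<Longrightarrow> column_strict (x i)" "\<And>i. i \<in> I \<Longrightarrow> row_weak (x i)"
    and inj: "\<And>i j. i \<in> I \<Longrightarrow> j \<in> I \<Longrightarrow> (\<And>m. m \<in> {1..k} \<Longrightarrow> x i m = x j m) \<Longrightarrow> i = j"
    and zero: "(\<Sum>i\<in>I. cscale (c i)
      (\<Sum>p\<in>columns. cscale (sgn_perm p) (basis_vec (content (x i \<circ> p))))) = 0"
    and "i \<in> I"
  shows "c i = 0"
proof (rule ccontr)
  assume "c i \<noteq> 0"
  define J where "J = {i \<in> I. c i \<noteq> 0}"
  have J: "finite J" "J \<noteq> {}" using I \<open>i \<in> I\<close> \<open>c i \<noteq> 0\<close> by (auto simp: J_def)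
  have "Max ((\<lambda>i. row_sum (x i)) ` J) \<in> (\<lambda>i. row_sum (x i)) ` J"
    using J by (intro Max_in) auto
  then obtain j where j: "j \<in> J" "row_sum (x j) = Max ((\<lambda>i. row_sum (x i)) ` J)"
    unfolding image_iff by metis
  have max: "row_sum (x i) \<le> row_sum (x j)" if "i \<in> J" for i
    unfolding j(2) using J that by (intro Max_ge) auto
  have jI: "j \<in> I" "c j \<noteq> 0" using j by (auto simp: J_def)
  \<comment> \<open>If the contents agree, then
    \<open>row_sum (x i \<circ> p) = row_sum (x j)\<close> is at least \<open>row_sum (x i)\<close>
    by maximality. This forces \<open>p = id\<close>, and then \<open>i = j\<close> since row
    contents determine a semistandard filling.\<close>
  have coeff: "c i * (sgn_perm p * Poly_Mapping.lookup (basis_vec (content (x i \<circ> p))) (content (x j)))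
      = (if i = j \<and> p = id then c j else 0)" if i: "i \<in> I" and p: "p \<in> columns" for i p
  proof (cases "c i \<noteq> 0 \<and> content (x i \<circ> p) = content (x j)")
    case True
    then have "row_sum (x i) \<le> row_sum (x i \<circ> p)"
      using max[of i] i by (simp add: row_sum_content J_def)
    then have "p = id" using row_sum_columns[OF ss(1)[OF i] p] by linarith
    then have "x i m = x j m" if "m \<in> {1..k}" for m
      using content_eqD[OF ss(2)[OF i] ss(2)[OF jI(1)] _ that] True by simp
    then have "i = j" using inj[OF i jI(1)] by blast
    then show ?thesis using \<open>p = id\<close> by simp
  next
    case False
    then show ?thesis using jI(2) by (auto simp: lookup_single)
  qed
  have "0 = Poly_Mapping.lookup (\<Sum>i\<in>I. cscale (c i)
      (\<Sum>p\<in>columns. cscale (sgn_perm p) (basis_vec (content (x i \<circ> p))))) (content (x j))"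
    by (simp only: zero lookup_zero)
  also have "\<dots> = (\<Sum>i\<in>I. \<Sum>p\<in>columns.
      c i * (sgn_perm p * Poly_Mapping.lookup (basis_vec (content (x i \<circ> p))) (content (x j))))"
    by (simp only: lookup_sum lookup_cscale sum_distrib_left)
  also have "\<dots> = (\<Sum>i\<in>I. \<Sum>p\<in>columns. if i = j \<and> p = id then c j else 0)"
    by (intro sum.cong refl coeff)
  also have "\<dots> = (\<Sum>i\<in>I. if i = j then \<Sum>p\<in>columns. if p = id then c j else 0 else 0)"
    by (intro sum.cong) auto
  also have "\<dots> = c j"
    using I jI finite_columns id_in_columns by simp
  finally show False using jI by simp
qed

end

subsection \<open>Specht modules\<close>

text \<open>Tableaux are not extensional; their values outside the diagram are discarded
  here.\<close>

lemma polytabloid_cong: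
  assumes "\<And>c. c \<in> diagram lam \<Longrightarrow> t c = t' c"
  shows "polytabloid k lam t = polytabloid k lam t'"
proof -
  have eq: "t ` {c \<in> diagram lam. P c} = t' ` {c \<in> diagram lam. P c}" for P
    by (rule image_cong) (use assms in auto)
  show ?thesis
    unfolding polytabloid_def column_stabilizer_def tabloid_def image_comp[symmetric] eq by (rule refl)
qed

lemma tabloid_comp_image: "map ((`) s) (tabloid lam u) = tabloid lam (s \<circ> u)"
  by (simp add: tabloid_def image_comp)

lemma specht_act_basis: "specht_act (basis_vec s) w = lin_ext (\<lambda>T. basis_vec (map ((`) s) T)) w"
  by (simp add: specht_act_def)

lemma specht_act_polytabloid_sum:
  "specht_act (basis_vec s) (polytabloid k lam t) = (\<Sum>p\<in>column_stabilizer k lam t.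
    cscale (of_int (sign p)) (basis_vec (tabloid lam (s \<circ> (p \<circ> t)))))"
  unfolding specht_act_basis polytabloid_def lin_ext_sum lin_ext_scale lin_ext_basis tabloid_comp_image
  by (rule refl)

lemma column_stabilizer_conjugate:
  assumes s: "s permutes {1..k}"
  shows "q \<in> column_stabilizer k lam (s \<circ> t) \<longleftrightarrow> inv' s \<circ> q \<circ> s \<in> column_stabilizer k lam t"
proof -
  have inv: "inv' s permutes {1..k}" by (rule permutes_inv[OF s])
  have ss: "s \<circ> inv' s = id" "inv' s \<circ> s = id" by (rule permutes_inv_o[OF s])+
  have "q permutes {1..k} \<longleftrightarrow> inv' s \<circ> q \<circ> s permutes {1..k}"
  proof
    assume "q permutes {1..k}"
    then show "inv' s \<circ> q \<circ> s permutes {1..k}" by (intro permutes_compose s inv)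
  next
    assume "inv' s \<circ> q \<circ> s permutes {1..k}"
    then have "s \<circ> (inv' s \<circ> q \<circ> s) \<circ> inv' s permutes {1..k}"
      by (rule permutes_compose[OF inv permutes_compose[OF _ s]])
    moreover have "s \<circ> (inv' s \<circ> q \<circ> s) \<circ> inv' s = q"
      by (simp add: fun_eq_iff permutes_inverses[OF s])
    ultimately show "q permutes {1..k}" by (simp only:)
  qed
  moreover have "q ` (s \<circ> t) ` X = (s \<circ> t) ` X \<longleftrightarrow> (inv' s \<circ> q \<circ> s) ` t ` X = t ` X" for X
  proof -
    have "q ` (s \<circ> t) ` X = (s \<circ> t) ` X \<longleftrightarrow> inv' s ` q ` (s \<circ> t) ` X = inv' s ` (s \<circ> t) ` X"
      using permutes_inj[OF inv] by (simp add: inj_image_eq_iff)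
    also have "inv' s ` (s \<circ> t) ` X = t ` X"
      by (simp add: image_comp comp_def permutes_inverses[OF s])
    finally show ?thesis by (simp add: image_comp comp_assoc)
  qed
  ultimately show ?thesis by (simp add: column_stabilizer_def sym_group_carrier)
qed

text \<open>Conjugation by \<open>s\<close> matches the two column stabilizers and preserves signs.
  Hence all polytabloids arise from a single one by the action of the symmetric group.\<close>

lemma specht_act_polytabloid:
  assumes s: "s permutes {1..k}"
  shows "specht_act (basis_vec s) (polytabloid k lam t) = polytabloid k lam (s \<circ> t)"
proof -
  have ss: "s \<circ> inv' s = id" "inv' s \<circ> s = id" by (rule permutes_inv_o[OF s])+
  have ss': "s \<circ> (inv' s \<circ> u) = u" "inv' s \<circ> (s \<circ> u) = u" for u :: "nat \<Rightarrow> nat"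
    by (simp_all add: ss comp_assoc[symmetric])
  have mem: "s \<circ> p \<circ> inv' s \<in> column_stabilizer k lam (s \<circ> t)" if "p \<in> column_stabilizer k lam t" for p
    unfolding column_stabilizer_conjugate[OF s] using that by (simp add: comp_assoc ss ss')
  have sgn: "sign (s \<circ> p \<circ> inv' s) = sign p" if "p \<in> column_stabilizer k lam t" for p
  proof -
    have "p permutes {1..k}" using that by (simp add: column_stabilizer_def sym_group_carrier)
    then have "permutation p" "permutation s" "permutation (inv' s)"
      unfolding permutation_permutes using s permutes_inv[OF s] by blast+
    then show ?thesis
      by (simp add: sign_compose sign_inverse permutation_compose mult.commute mult.left_commute sign_idempotent)
  qed
  show ?thesis
    unfolding specht_act_polytabloid_sum
    unfolding polytabloid_def[of k lam "s \<circ> t"]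
  proof (rule sum.reindex_bij_witness[of _ "\<lambda>q. inv' s \<circ> q \<circ> s" "\<lambda>p. s \<circ> p \<circ> inv' s"])
    fix p assume p: "p \<in> column_stabilizer k lam t"
    have "s \<circ> p \<circ> inv' s \<circ> (s \<circ> t) = s \<circ> (p \<circ> t)"
      by (simp add: fun_eq_iff permutes_inverses(2)[OF s])
    then show "cscale (of_int (sign (s \<circ> p \<circ> inv' s))) (basis_vec (tabloid lam (s \<circ> p \<circ> inv' s \<circ> (s \<circ> t)))) =
        cscale (of_int (sign p)) (basis_vec (tabloid lam (s \<circ> (p \<circ> t))))"
      by (simp only: sgn[OF p])
  qed (auto simp: mem column_stabilizer_conjugate[OF s] comp_assoc ss ss')
qed

lemma is_tableau_comp:
  assumes "is_tableau k lam t" "s permutes {1..k}"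
  shows "is_tableau k lam (s \<circ> t)"
  using bij_betw_trans[OF assms(1)[unfolded is_tableau_def] permutes_imp_bij[OF assms(2)]]
  by (simp add: is_tableau_def)

lemma polytabloid_carrier:
  assumes "is_tableau k lam t"
  shows "polytabloid k lam t \<in> carrier (free_space (tabloids k lam))"
  unfolding polytabloid_def carrier_free_space_eq_span
proof (intro free.span_sum free.span_scale free.span_base imageI)
  fix p assume "p \<in> column_stabilizer k lam t"
  then have "is_tableau k lam (p \<circ> t)"
    by (intro is_tableau_comp assms) (simp add: column_stabilizer_def sym_group_carrier)
  then show "tabloid lam (p \<circ> t) \<in> tabloids k lam" by (auto simp: tabloids_def)
qed

lemma carrier_specht:
  "carrier (specht k lam) = free.span {polytabloid k lam t | t. is_tableau k lam t}"
  unfolding specht_def Let_def using polytabloid_carrier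
  by (subst span_free_space_eq) auto

lemma zero_specht [simp]: "\<zero>\<^bsub>specht k lam\<^esub> = 0"
  and add_specht [simp]: "u \<oplus>\<^bsub>specht k lam\<^esub> v = u + v"
  and smult_specht [simp]: "c \<odot>\<^bsub>specht k lam\<^esub> v = cscale c v"
  by (simp_all add: specht_def free_space_def)

lemma carrier_specht_subset: "carrier (specht k lam) \<subseteq> carrier (free_space (tabloids k lam))"
  unfolding carrier_specht
  by (intro free.span_minimal subspace_carrier_free_space) (use polytabloid_carrier in blast)

lemma subspace_carrier_specht: "free.subspace (carrier (specht k lam))"
  by (simp add: carrier_specht)

lemma lin_ext_in_subspace:
  assumes "free.subspace N" "\<And>x. x \<in> Poly_Mapping.keys v \<Longrightarrow> f x \<in> N"
  shows "lin_ext f v \<in> N"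
  unfolding lin_ext_def using assms by (intro free.subspace_sum free.subspace_scale) auto

lemma group_algebra_keys: "b \<in> group_algebra k \<Longrightarrow> s \<in> Poly_Mapping.keys b \<Longrightarrow> s permutes {1..k}"
  by (auto simp: group_algebra_def carrier_free_space sym_group_carrier dest: subsetD)

lemma basis_in_group_algebra: "s permutes {1..k} \<Longrightarrow> basis_vec s \<in> group_algebra k"
  by (simp add: group_algebra_def carrier_free_space sym_group_carrier)

lemma specht_act_carrier:
  assumes "b \<in> group_algebra k" "w \<in> carrier (specht k lam)"
  shows "specht_act b w \<in> carrier (specht k lam)"
  unfolding specht_act_def
proof (rule lin_ext_in_subspace[OF subspace_carrier_specht])
  fix s assume "s \<in> Poly_Mapping.keys b"
  then have s: "s permutes {1..k}" by (rule group_algebra_keys[OF assms(1)])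
  let ?f = "lin_ext (\<lambda>T. basis_vec (map ((`) s) T))"
  show "?f w \<in> carrier (specht k lam)"
    using assms(2) unfolding carrier_specht
  proof (induction rule: free.span_induct_alt)
    case (step c x y)
    then obtain t where t: "x = polytabloid k lam t" "is_tableau k lam t" by blast
    then have "?f x \<in> {polytabloid k lam t | t. is_tableau k lam t}"
      using specht_act_polytabloid[OF s] is_tableau_comp[OF t(2) s] by (auto simp: specht_act_basis)
    then show ?case
      using step.IH by (simp add: lin_ext_add lin_ext_scale free.span_add free.span_scale free.span_base)
  qed (simp add: free.span_zero)
qed

subsection \<open>The tensor product\<close>

text \<open>Elements of \<open>Ltilde_class n k\<close> are represented by total functions, which
  compose directly with permutations; only the values on \<open>{1..k}\<close> count.\<close>

definition total_map :: "nat \<Rightarrow> (nat \<Rightarrow> nat) \<Rightarrow> (nat \<rightharpoonup> nat)" where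
  "total_map k x = (Some \<circ> x) |` {1..k}"

lemma total_map_cong: "(\<And>m. m \<in> {1..k} \<Longrightarrow> x m = y m) \<Longrightarrow> total_map k x = total_map k y"
  by (auto simp: total_map_def restrict_map_def fun_eq_iff)

lemma total_map_compose:
  assumes "s permutes {1..k}"
  shows "total_map k x \<circ>\<^sub>m total_map k s = total_map k (x \<circ> s)"
  using permutes_in_image[OF assms] by (auto simp: total_map_def map_comp_def restrict_map_def fun_eq_iff)

lemma Ltilde_class_total_map:
  assumes "k \<le> n"
  shows "Ltilde_class n k = {total_map k x | x. x ` {1..k} \<subseteq> {1..n}}"
proof (intro equalityI subsetI)
  fix f assume "f \<in> Ltilde_class n k"
  then have f: "dom f = {1..k}" "ran f \<subseteq> {1..n}"
    by (auto simp: Ltilde_class_eq[OF assms] PT_def)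
  define x where "x m = the (f m)" for m
  have "f m = total_map k x m" for m
  proof (cases "m \<in> {1..k}")
    case True
    then obtain y where "f m = Some y" using f(1) by blast
    then show ?thesis using True by (simp add: total_map_def x_def)
  next
    case False
    then have "f m = None" using f(1) by blast
    then show ?thesis using False by (simp add: total_map_def)
  qed
  then have "f = total_map k x" by (rule ext)
  moreover have "x ` {1..k} \<subseteq> {1..n}"
  proof
    fix y assume "y \<in> x ` {1..k}"
    then obtain m where m: "m \<in> dom f" "y = x m" using f(1) by blast
    then have "f m = Some y" by (auto simp: x_def)
    then show "y \<in> {1..n}" using f(2) by (auto intro: ranI)
  qed
  ultimately show "f \<in> {total_map k x | x. x ` {1..k} \<subseteq> {1..n}}" by blast
next
  fix f assume "f \<in> {total_map k x | x. x ` {1..k} \<subseteq> {1..n}}"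
  then obtain x where x: "f = total_map k x" "x ` {1..k} \<subseteq> {1..n}" by blast
  have "dom f = {1..k}" by (auto simp: x(1) total_map_def)
  moreover have "ran f \<subseteq> {1..n}" using x by (auto simp: total_map_def ran_def restrict_map_def split: if_splits)
  ultimately show "f \<in> Ltilde_class n k" using assms by (auto simp: Ltilde_class_eq PT_def)
qed

lemma right_sym_act_basis:
  "right_sym_act k v (basis_vec s) = lin_ext (\<lambda>x. basis_vec (x \<circ>\<^sub>m total_map k s)) v"
  by (simp add: right_sym_act_def total_map_def)

lemma right_sym_act_carrier:
  assumes "k \<le> n" "v \<in> carrier (free_space (Ltilde_class n k))" "b \<in> group_algebra k"
  shows "right_sym_act k v b \<in> carrier (free_space (Ltilde_class n k))"
  unfolding right_sym_act_def
proof (intro lin_ext_in_subspace[OF subspace_carrier_free_space])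
  fix s x assume "s \<in> Poly_Mapping.keys b" "x \<in> Poly_Mapping.keys v"
  then have s: "s permutes {1..k}" and "x \<in> Ltilde_class n k"
    using assms(2) group_algebra_keys[OF assms(3)] by (auto simp: carrier_free_space)
  then obtain y where y: "x = total_map k y" "y ` {1..k} \<subseteq> {1..n}"
    by (auto simp: Ltilde_class_total_map[OF assms(1)])
  have "x \<circ>\<^sub>m total_map k s \<in> Ltilde_class n k"
    unfolding y(1) total_map_compose[OF s] Ltilde_class_total_map[OF assms(1)]
    using y(2) permutes_image[OF s] by (intro CollectI exI[of _ "y \<circ> s"]) (simp only: image_comp[symmetric])
  then show "basis_vec (x \<circ>\<^sub>m (Some \<circ> s) |` {1..k}) \<in> carrier (free_space (Ltilde_class n k))"
    by (simp add: carrier_free_space total_map_def)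
qed


section \<open>Calculus modulo the tensor relations\<close>

context
  fixes n k :: nat and lam :: "nat list"
  assumes kn: "k \<le> n"
begin

abbreviation (input) "left_space \<equiv> free_space (Ltilde_class n k)"
abbreviation (input) "pairs \<equiv> carrier left_space \<times> carrier (specht k lam)"
abbreviation (input) "relations \<equiv>
  tensor_relations (group_algebra k) left_space (right_sym_act k) (specht k lam) specht_act"

lemma relations_carrier: "relations \<subseteq> carrier (free_space pairs)"
proof -
  note S = subspace_carrier_free_space[of "Ltilde_class n k"] subspace_carrier_specht[of k lam]
    subspace_carrier_free_space[of pairs]
  have b: "basis_vec (v, w) \<in> carrier (free_space pairs)"
    if "v \<in> carrier left_space" "w \<in> carrier (specht k lam)" for v w
    using that by (simp add: carrier_free_space)
  show ?thesis
    unfolding tensor_relations_def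
    by (auto simp only: add_free_space smult_free_space add_specht smult_specht
        intro!: b free.subspace_add[OF S(1)] free.subspace_add[OF S(2)]
          free.subspace_scale[OF S(1)] free.subspace_scale[OF S(2)] free.subspace_scale[OF S(3)]
          free.subspace_diff[OF S(3)] specht_act_carrier right_sym_act_carrier[OF kn])
qed

definition relation_space where "relation_space = free.span relations"

lemma subspace_relation_space: "free.subspace relation_space"
  by (simp add: relation_space_def)

lemma relation_space_carrier: "relation_space \<subseteq> carrier (free_space pairs)"
  unfolding relation_space_def by (intro free.span_minimal relations_carrier subspace_carrier_free_space)

text \<open>This brings the module into the form required by \<open>dim_quotient\<close>.\<close>

lemma PT_module_eq:
  "PT_module n k lam = quotient_module (free_space pairs) relation_space
    (\<lambda>a. lin_ext (\<lambda>(x, y). basis_vec (PT_act n k a x, y)))"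
  unfolding PT_module_def tensor_module_def Let_def relation_space_def
  by (simp only: span_free_space_eq[OF relations_carrier])

lemma relation_space_add_left: "v \<in> carrier left_space \<Longrightarrow> v' \<in> carrier left_space \<Longrightarrow> w \<in> carrier (specht k lam)
    \<Longrightarrow> basis_vec (v + v', w) - basis_vec (v, w) - basis_vec (v', w) \<in> relation_space"
  and relation_space_add_right: "v \<in> carrier left_space \<Longrightarrow> w \<in> carrier (specht k lam) \<Longrightarrow> w' \<in> carrier (specht k lam)
    \<Longrightarrow> basis_vec (v, w + w') - basis_vec (v, w) - basis_vec (v, w') \<in> relation_space"
  and relation_space_scale_left: "v \<in> carrier left_space \<Longrightarrow> w \<in> carrier (specht k lam)
    \<Longrightarrow> basis_vec (cscale c v, w) - cscale c (basis_vec (v, w)) \<in> relation_space"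
  and relation_space_scale_right: "v \<in> carrier left_space \<Longrightarrow> w \<in> carrier (specht k lam)
    \<Longrightarrow> basis_vec (v, cscale c w) - cscale c (basis_vec (v, w)) \<in> relation_space"
  and relation_space_balanced: "v \<in> carrier left_space \<Longrightarrow> w \<in> carrier (specht k lam) \<Longrightarrow> b \<in> group_algebra k
    \<Longrightarrow> basis_vec (right_sym_act k v b, w) - basis_vec (v, specht_act b w) \<in> relation_space"
  unfolding relation_space_def
  by (rule free.span_base, simp only: tensor_relations_def add_free_space smult_free_space
      add_specht smult_specht, blast)+

text \<open>A pair with second entry 0 is a basis vector of the free space on pairs, not 0 itself;
  the scaling relation with factor 0 puts it into the relation space.\<close>

lemma relation_space_zero_right: "v \<in> carrier left_space \<Longrightarrow> basis_vec (v, 0) \<in> relation_space"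
  using relation_space_scale_right[of v 0 0] free.subspace_0[OF subspace_carrier_specht]
  by (simp add: free.scale_zero_left del: Poly_Mapping.map_single)

lemma relation_space_zero_left: "w \<in> carrier (specht k lam) \<Longrightarrow> basis_vec (0, w) \<in> relation_space"
  using relation_space_scale_left[of 0 w 0] free.subspace_0[OF subspace_carrier_free_space[of "Ltilde_class n k"]]
  by (simp add: free.scale_zero_left del: Poly_Mapping.map_single)

lemma telescope: "(a - b - c) + (b - d) + (c - e) = a - (d + e)" for a :: "'z :: ab_group_add"
  by simp

lemma relation_space_sum_right:
  assumes "finite I" "v \<in> carrier left_space" "\<And>i. i \<in> I \<Longrightarrow> w i \<in> carrier (specht k lam)"
  shows "basis_vec (v, \<Sum>i\<in>I. cscale (c i) (w i)) - (\<Sum>i\<in>I. cscale (c i) (basis_vec (v, w i))) \<in> relation_space"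
  using assms
proof (induction I rule: finite_induct)
  case empty
  then show ?case using relation_space_zero_right by simp
next
  case (insert i I)
  let ?s = "\<Sum>i\<in>I. cscale (c i) (w i)" and ?t = "\<Sum>i\<in>I. cscale (c i) (basis_vec (v, w i))"
  note S = subspace_carrier_specht[of k lam]
  have wi: "w i \<in> carrier (specht k lam)" using insert by simp
  have "(basis_vec (v, cscale (c i) (w i) + ?s) - basis_vec (v, cscale (c i) (w i)) - basis_vec (v, ?s))
      + (basis_vec (v, cscale (c i) (w i)) - cscale (c i) (basis_vec (v, w i)))
      + (basis_vec (v, ?s) - ?t) \<in> relation_space"
  proof (intro free.subspace_add[OF subspace_relation_space])
    show "basis_vec (v, cscale (c i) (w i) + ?s) - basis_vec (v, cscale (c i) (w i)) - basis_vec (v, ?s) \<in> relation_space"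
      using insert by (intro relation_space_add_right free.subspace_scale[OF S] free.subspace_sum[OF S]) auto
  qed (use insert wi relation_space_scale_right in auto)
  then show ?case by (simp only: sum.insert[OF insert.hyps] telescope)
qed

end

text \<open>As \<open>SSYT\<close>, but without prescribed content and with entries up to
  \<open>n\<close>. This set indexes the basis of the tensor product.\<close>

definition semistandard_tableaux :: "nat list \<Rightarrow> nat \<Rightarrow> (nat \<times> nat \<Rightarrow> nat) set" where
  "semistandard_tableaux lam n =
    {T \<in> diagram lam \<rightarrow>\<^sub>E {1..n}.
      (\<forall>i j j'. (i, j) \<in> diagram lam \<and> (i, j') \<in> diagram lam \<and> j < j' \<longrightarrow> T (i, j) \<le> T (i, j')) \<and>
      (\<forall>i i' j. (i, j) \<in> diagram lam \<and> (i', j) \<in> diagram lam \<and> i < i' \<longrightarrow> T (i, j) < T (i', j))}"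

lemma finite_diagram: "finite (diagram lam)"
proof -
  have "diagram lam = (SIGMA i:{..<length lam}. {..<lam ! i})" by (auto simp: diagram_def)
  then show ?thesis by simp
qed

lemma card_diagram: "card (diagram lam) = sum_list lam"
proof -
  have "diagram lam = (SIGMA i:{..<length lam}. {..<lam ! i})" by (auto simp: diagram_def)
  then show ?thesis by (simp add: sum_list_sum_nth atLeast0LessThan)
qed

lemma finite_semistandard_tableaux: "finite (semistandard_tableaux lam n)"
  by (rule finite_subset[of _ "diagram lam \<rightarrow>\<^sub>E {1..n}"])
    (auto simp: semistandard_tableaux_def finite_diagram intro: finite_PiE)

section \<open>Row contents as an invariant of tensors\<close>

definition row_contents :: "(nat \<rightharpoonup> nat) \<Rightarrow> nat set list \<Rightarrow> nat multiset list" where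
  "row_contents x T = map (\<lambda>R. image_mset (\<lambda>m. the (x m)) (mset_set R)) T"

text \<open>A bilinear map that is balanced on the Specht module and therefore factors through the
  tensor product, where it serves to detect linear independence.\<close>

definition contents_form ::
  "((nat \<rightharpoonup> nat) \<Rightarrow>\<^sub>0 complex) \<Rightarrow> (nat set list \<Rightarrow>\<^sub>0 complex) \<Rightarrow> (nat multiset list \<Rightarrow>\<^sub>0 complex)" where
  "contents_form v w = lin_ext (\<lambda>x. lin_ext (\<lambda>T. basis_vec (row_contents x T)) w) v"

definition contents_map ::
  "(((nat \<rightharpoonup> nat) \<Rightarrow>\<^sub>0 complex) \<times> (nat set list \<Rightarrow>\<^sub>0 complex) \<Rightarrow>\<^sub>0 complex) \<Rightarrow> (nat multiset list \<Rightarrow>\<^sub>0 complex)" where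
  "contents_map = lin_ext (\<lambda>(v, w). contents_form v w)"

lemma contents_form_add_left: "contents_form (v + v') w = contents_form v w + contents_form v' w"
  and contents_form_scale_left: "contents_form (cscale c v) w = cscale c (contents_form v w)"
  and contents_form_add_right: "contents_form v (w + w') = contents_form v w + contents_form v w'"
  and contents_form_scale_right: "contents_form v (cscale c w) = cscale c (contents_form v w)"
  unfolding contents_form_def lin_ext_add lin_ext_scale lin_ext_fun_add lin_ext_fun_scale
  by (rule refl)+

text \<open>As \<open>s\<close> is injective, the entries of \<open>x\<close> after \<open>s\<close>
  on a row \<open>R\<close> are, with multiplicity, those of \<open>x\<close> on the image of
  \<open>R\<close>. This is balancedness on basis elements.\<close>

lemma row_contents_compose:
  assumes s: "s permutes {1..k}" and T: "T \<in> tabloids k lam"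
  shows "row_contents (x \<circ>\<^sub>m total_map k s) T = row_contents x (map ((`) s) T)"
proof -
  obtain t where t: "is_tableau k lam t" "T = tabloid lam t" using T by (auto simp: tabloids_def)
  \<comment> \<open>All rows lie in \<open>{1..k}\<close>, where \<open>total_map k s\<close> is
    defined.\<close>
  have sub: "R \<subseteq> {1..k}" if "R \<in> set T" for R
    using that t bij_betw_imp_surj_on[OF t(1)[unfolded is_tableau_def]] by (auto simp: tabloid_def)
  have "image_mset (\<lambda>m. the ((x \<circ>\<^sub>m total_map k s) m)) (mset_set R)
      = image_mset (\<lambda>m. the (x m)) (mset_set (s ` R))" if R: "R \<in> set T" for R
  proof -
    have "finite R" using sub[OF R] finite_subset by blast
    have "image_mset (\<lambda>m. the (x m)) (mset_set (s ` R)) = image_mset (\<lambda>m. the (x (s m))) (mset_set R)"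
      using image_mset_mset_set[of s R] inj_on_subset[OF permutes_inj[OF s]]
      by (metis (no_types, lifting) multiset.map_comp comp_def image_mset_cong subset_UNIV)
    also have "\<dots> = image_mset (\<lambda>m. the ((x \<circ>\<^sub>m total_map k s) m)) (mset_set R)"
      using sub[OF R] \<open>finite R\<close> by (intro image_mset_cong) (auto simp: map_comp_def total_map_def)
    finally show ?thesis by simp
  qed
  then show ?thesis by (simp add: row_contents_def)
qed

lemma contents_form_balanced:
  assumes "b \<in> group_algebra k" "w \<in> carrier (specht k lam)"
  shows "contents_form (right_sym_act k v b) w = contents_form v (specht_act b w)"
proof -
  have w: "T \<in> tabloids k lam" if "T \<in> Poly_Mapping.keys w" for T
    using that assms(2) carrier_specht_subset by (auto simp: carrier_free_space)
  have "contents_form (right_sym_act k v b) w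
      = lin_ext (\<lambda>s. lin_ext (\<lambda>x. lin_ext (\<lambda>T. basis_vec (row_contents (x \<circ>\<^sub>m total_map k s) T)) w) v) b"
    unfolding contents_form_def right_sym_act_def lin_ext_lin_ext lin_ext_basis total_map_def by (rule refl)
  also have "\<dots> = lin_ext (\<lambda>s. lin_ext (\<lambda>x. lin_ext (\<lambda>T. basis_vec (row_contents x (map ((`) s) T))) w) v) b"
    by (intro lin_ext_cong arg_cong[of _ _ basis_vec]
        row_contents_compose[OF group_algebra_keys[OF assms(1)] w])
  also have "\<dots> = lin_ext (\<lambda>x. lin_ext (\<lambda>s. lin_ext (\<lambda>T. basis_vec (row_contents x (map ((`) s) T))) w) b) v"
    by (rule lin_ext_commute)
  also have "\<dots> = contents_form v (specht_act b w)"
    unfolding contents_form_def specht_act_def lin_ext_lin_ext lin_ext_basis by (rule refl)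
  finally show ?thesis .
qed

lemma contents_map_basis: "contents_map (basis_vec (v, w)) = contents_form v w"
  by (simp add: contents_map_def)

text \<open>The kernel of a linear map is a subspace, so it suffices to check the generating
  relations.\<close>

lemma contents_map_relation_space:
  assumes "k \<le> n" "u \<in> relation_space n k lam"
  shows "contents_map u = 0"
proof -
  have "free.subspace {u. contents_map u = 0}"
    by (auto simp: free.subspace_def contents_map_def lin_ext_add lin_ext_scale)
  moreover have "tensor_relations (group_algebra k) (free_space (Ltilde_class n k)) (right_sym_act k)
      (specht k lam) specht_act \<subseteq> {u. contents_map u = 0}"
  proof -
    have d: "contents_map (u - v) = contents_map u - contents_map v"
      and c: "contents_map (cscale c u) = cscale c (contents_map u)" for u v c
      by (simp_all only: contents_map_def lin_ext_diff lin_ext_scale)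
    show ?thesis
      unfolding tensor_relations_def add_free_space smult_free_space add_specht smult_specht
      by (auto simp only: d c contents_map_basis contents_form_add_left contents_form_scale_left
          contents_form_add_right contents_form_scale_right contents_form_balanced
          diff_self add_diff_cancel_left' mem_Collect_eq)
  qed
  ultimately have "relation_space n k lam \<subseteq> {u. contents_map u = 0}"
    unfolding relation_space_def[OF assms(1)] by (intro free.span_minimal)
  then show ?thesis using assms(2) by blast
qed

section \<open>A basis of the tensor product\<close>

context young_tableau
begin

text \<open>With \<open>semistandard_tableaux_restrict\<close>, this translates between tableaux on
  the cells and fillings on \<open>{1..k}\<close>.\<close>

lemma semistandard_tableaux_cell:
  assumes "T \<in> semistandard_tableaux lam n"
  shows "(T \<circ> cell) ` {1..k} \<subseteq> {1..n}" "column_strict (T \<circ> cell)" "row_weak (T \<circ> cell)"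
proof -
  show "(T \<circ> cell) ` {1..k} \<subseteq> {1..n}"
    using assms cell_in_diagram unfolding semistandard_tableaux_def
    by (auto simp only: comp_apply dest!: PiE_mem)
  have "T (row a, col a) < T (row b, col a)"
    if "a \<in> {1..k}" "b \<in> {1..k}" "col a = col b" "row a < row b" for a b
    using assms that cell_in_diagram[OF that(1)] cell_in_diagram[OF that(2)]
    unfolding semistandard_tableaux_def by (metis (mono_tags, lifting) mem_Collect_eq prod.collapse)
  then show "column_strict (T \<circ> cell)"
    unfolding column_strict_def comp_apply by (metis prod.collapse)
  have "T (row a, col a) \<le> T (row a, col b)"
    if "a \<in> {1..k}" "b \<in> {1..k}" "row a = row b" "col a < col b" for a b
    using assms that cell_in_diagram[OF that(1)] cell_in_diagram[OF that(2)]
    unfolding semistandard_tableaux_def by (metis (mono_tags, lifting) mem_Collect_eq prod.collapse)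
  then show "row_weak (T \<circ> cell)"
    unfolding row_weak_def comp_apply by (metis prod.collapse)
qed

lemma semistandard_tableaux_eqI:
  assumes "T \<in> semistandard_tableaux lam n" "T' \<in> semistandard_tableaux lam n"
    and "\<And>m. m \<in> {1..k} \<Longrightarrow> (T \<circ> cell) m = (T' \<circ> cell) m"
  shows "T = T'"
proof (rule PiE_ext)
  show "T \<in> diagram lam \<rightarrow>\<^sub>E {1..n}" "T' \<in> diagram lam \<rightarrow>\<^sub>E {1..n}"
    using assms(1,2) by (auto simp: semistandard_tableaux_def)
  show "T c = T' c" if "c \<in> diagram lam" for c
    using assms(3)[OF t_in[OF that]] that by simp
qed

lemma semistandard_tableaux_restrict:
  assumes "x ` {1..k} \<subseteq> {1..n}" "column_strict x" "row_weak x"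
  shows "restrict (x \<circ> t) (diagram lam) \<in> semistandard_tableaux lam n"
proof -
  have "x (t (i, j)) \<le> x (t (i, j'))"
    if "(i, j) \<in> diagram lam" "(i, j') \<in> diagram lam" "j < j'" for i j j'
    using assms(3) t_in[OF that(1)] t_in[OF that(2)] cell_t[OF that(1)] cell_t[OF that(2)] that(3)
    unfolding row_weak_def by (metis fst_conv snd_conv)
  moreover have "x (t (i, j)) < x (t (i', j))"
    if "(i, j) \<in> diagram lam" "(i', j) \<in> diagram lam" "i < i'" for i i' j
    using assms(2) t_in[OF that(1)] t_in[OF that(2)] cell_t[OF that(1)] cell_t[OF that(2)] that(3)
    unfolding column_strict_def by (metis fst_conv snd_conv)
  moreover have "x (t c) \<in> {1..n}" if "c \<in> diagram lam" for c
    using assms(1) t_in[OF that] by blast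
  ultimately show ?thesis
    by (simp add: semistandard_tableaux_def)
qed

context
  fixes n :: nat
  assumes kn: "k \<le> n"
begin

abbreviation (input) "pol \<equiv> polytabloid k lam t"
abbreviation (input) "N0 \<equiv> relation_space n k lam"

text \<open>A representative of \<open>x \<otimes> e\<close> in the free space on pairs, before
  passing to the quotient.\<close>

definition filling_tensor ::
  "(nat \<Rightarrow> nat) \<Rightarrow> (((nat \<rightharpoonup> nat) \<Rightarrow>\<^sub>0 complex) \<times> (nat set list \<Rightarrow>\<^sub>0 complex) \<Rightarrow>\<^sub>0 complex)" where
  "filling_tensor x = basis_vec (basis_vec (total_map k x), pol)"

lemma polytabloid_in_specht: "pol \<in> carrier (specht k lam)"
  unfolding carrier_specht using tableau by (intro free.span_base) auto

lemma total_map_in_carrier: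
  "x ` {1..k} \<subseteq> {1..n} \<Longrightarrow> basis_vec (total_map k x) \<in> carrier (free_space (Ltilde_class n k))"
  using Ltilde_class_total_map[OF kn] by (auto simp: carrier_free_space)

lemma specht_act_pol:
  "specht_act (basis_vec s) pol
    = (\<Sum>p\<in>columns. cscale (sgn_perm p) (basis_vec (tabloid_of (s \<circ> p))))"
  unfolding specht_act_polytabloid_sum column_stabilizer_eq comp_assoc[symmetric] tabloid_comp
  by (rule refl)

text \<open>Left multiplication by \<open>p\<close> permutes the column group and multiplies each
  sign by the sign of \<open>p\<close>.\<close>

lemma specht_act_pol_column:
  assumes p: "p \<in> columns"
  shows "specht_act (basis_vec p) pol = cscale (sgn_perm p) pol"
proof -
  have perm: "p permutes {1..k}" by (rule columns_permutes[OF p])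
  have pp: "p \<circ> (inv' p \<circ> u) = u" "inv' p \<circ> (p \<circ> u) = u" for u :: "nat \<Rightarrow> nat"
    by (simp_all add: fun_eq_iff permutes_inverses[OF perm])
  have sgn: "sgn_perm p * sgn_perm (p \<circ> q) = sgn_perm q" if "q \<in> columns" for q
    using sgn_perm_compose[OF _ _ perm columns_permutes[OF that]] sign_idempotent[of p]
    by (simp flip: of_int_mult mult.assoc)
  have "(\<Sum>q\<in>columns. cscale (sgn_perm q) (basis_vec (tabloid_of (p \<circ> q))))
      = (\<Sum>r\<in>columns. cscale (sgn_perm p) (cscale (sgn_perm r) (basis_vec (tabloid_of r))))"
    by (rule sum.reindex_bij_witness[of _ "\<lambda>r. inv' p \<circ> r" "\<lambda>q. p \<circ> q"])
      (auto simp only: pp columns_compose[OF p] columns_compose[OF columns_inv[OF p]]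
        free.scale_scale sgn)
  then show ?thesis
    unfolding specht_act_pol unfolding polytabloid_eq free.scale_sum_right .
qed

lemma filling_tensor_compose:
  assumes "x ` {1..k} \<subseteq> {1..n}" "s permutes {1..k}"
  shows "filling_tensor (x \<circ> s) - basis_vec (basis_vec (total_map k x), specht_act (basis_vec s) pol) \<in> N0"
  using relation_space_balanced[OF kn total_map_in_carrier[OF assms(1)] polytabloid_in_specht
      basis_in_group_algebra[OF assms(2)]]
  unfolding right_sym_act_basis lin_ext_basis total_map_compose[OF assms(2)] filling_tensor_def .

lemma filling_tensor_column:
  assumes "x ` {1..k} \<subseteq> {1..n}" "p \<in> columns"
  shows "filling_tensor (x \<circ> p) - cscale (sgn_perm p) (filling_tensor x) \<in> N0"
proof -
  have "basis_vec (basis_vec (total_map k x), cscale (sgn_perm p) pol) - cscale (sgn_perm p) (filling_tensor x) \<in> N0"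
    unfolding filling_tensor_def
    by (rule relation_space_scale_right[OF kn total_map_in_carrier[OF assms(1)] polytabloid_in_specht])
  then show ?thesis
    using filling_tensor_compose[OF assms(1) columns_permutes[OF assms(2)]]
      free.subspace_add[OF subspace_relation_space[OF kn]]
    unfolding specht_act_pol_column[OF assms(2)] by fastforce
qed

text \<open>Moving each \<open>s\<close> to the right factor turns the sum into the tensor of
  \<open>x\<close> with a Garnir sum of polytabloids, which is zero.\<close>

lemma filling_tensor_garnir:
  assumes x: "x ` {1..k} \<subseteq> {1..n}" and ij: "j < j'" "(i, j') \<in> diagram lam"
  shows "(\<Sum>s | s permutes garnir_set i j j'. cscale (sgn_perm s) (filling_tensor (x \<circ> s))) \<in> N0"
proof -
  let ?P = "{s. s permutes garnir_set i j j'}"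
  let ?v = "basis_vec (total_map k x)"
  let ?act = "\<lambda>s. specht_act (basis_vec s) pol"
  note N = subspace_relation_space[OF kn, of lam]
  have finP: "finite ?P" by (simp add: finite_permutations)
  have perm: "s permutes {1..k}" if "s \<in> ?P" for s
    by (rule permutes_subset[of s "garnir_set i j j'"])
      (use that in \<open>auto simp: lower_part_def upper_part_def\<close>)
  have "(\<Sum>s\<in>?P. cscale (sgn_perm s) (?act s)) = 0"
    unfolding specht_act_pol by (rule garnir_relation[OF ij])
  then have "basis_vec (?v, \<Sum>s\<in>?P. cscale (sgn_perm s) (?act s)) \<in> N0"
    using relation_space_zero_right[OF kn total_map_in_carrier[OF x]] by simp
  moreover have "basis_vec (?v, \<Sum>s\<in>?P. cscale (sgn_perm s) (?act s))
      - (\<Sum>s\<in>?P. cscale (sgn_perm s) (basis_vec (?v, ?act s))) \<in> N0"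
    by (intro relation_space_sum_right[OF kn finP total_map_in_carrier[OF x]] specht_act_carrier
        basis_in_group_algebra perm polytabloid_in_specht)
  ultimately have in1: "(\<Sum>s\<in>?P. cscale (sgn_perm s) (basis_vec (?v, ?act s))) \<in> N0"
    using free.subspace_diff[OF N] by fastforce
  have "(\<Sum>s\<in>?P. cscale (sgn_perm s) (filling_tensor (x \<circ> s) - basis_vec (?v, ?act s))) \<in> N0"
    by (intro free.subspace_sum[OF N] free.subspace_scale[OF N] filling_tensor_compose x perm)
  then have "(\<Sum>s\<in>?P. cscale (sgn_perm s) (filling_tensor (x \<circ> s)))
      - (\<Sum>s\<in>?P. cscale (sgn_perm s) (basis_vec (?v, ?act s))) \<in> N0"
    by (simp only: free.scale_right_diff_distrib sum_subtractf)
  from free.subspace_add[OF N this in1] show ?thesis by (simp only: diff_add_cancel)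
qed

text \<open>Straightening handles fillings paired with the fixed polytabloid. The other polytabloids
  follow by moving a permutation to the left factor, and arbitrary pairs by linearity, first in the
  left and then in the right entry.\<close>

lemma pairs_spanned:
  "carrier (free_space (carrier (free_space (Ltilde_class n k)) \<times> carrier (specht k lam)))
    \<subseteq> free.span (N0 \<union> (\<lambda>T. filling_tensor (T \<circ> cell)) ` semistandard_tableaux lam n)"
    (is "_ \<subseteq> free.span (N0 \<union> ?G)")
proof -
  let ?V = "carrier (free_space (Ltilde_class n k))"
  let ?S = "carrier (specht k lam)"
  define N where "N = free.span (N0 \<union> ?G)"
  have N: "free.subspace N" by (simp add: N_def)
  have N0: "u \<in> N" if "u \<in> N0" for u using that by (simp add: N_def free.span_base)
  have mod_N0: "u \<in> N" if "u - v \<in> N0" "v \<in> N" for u v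
    using free.subspace_add[OF N N0[OF that(1)] that(2)] by simp
  have mod_N0': "u \<in> N" if "v - u \<in> N0" "v \<in> N" for u v
    using free.subspace_diff[OF N that(2) N0[OF that(1)]] by simp
  have filling_tensor_N: "filling_tensor x \<in> N" if "x ` {1..k} \<subseteq> {1..n}" for x
  proof (rule straightening[OF N _ _ _ that])
    fix x assume x: "x ` {1..k} \<subseteq> {1..n}" "column_strict x" "row_weak x"
    let ?T = "restrict (x \<circ> t) (diagram lam)"
    have "total_map k x = total_map k (?T \<circ> cell)"
      by (rule total_map_cong) (simp add: cell_in_diagram)
    then have "filling_tensor x = filling_tensor (?T \<circ> cell)" by (simp add: filling_tensor_def)
    then have "filling_tensor x \<in> ?G" using semistandard_tableaux_restrict[OF x] by blast
    then show "filling_tensor x \<in> N" by (simp add: N_def free.span_base)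
  qed (use filling_tensor_column filling_tensor_garnir N0 in blast)+
  have step1: "basis_vec (basis_vec f, polytabloid k lam t') \<in> N"
    if f: "f \<in> Ltilde_class n k" and t': "is_tableau k lam t'" for f t'
  proof -
    obtain x where x: "f = total_map k x" "x ` {1..k} \<subseteq> {1..n}"
      using f Ltilde_class_total_map[OF kn] by auto
    \<comment> \<open>On \<open>{1..k}\<close> this is \<open>t'\<close> after the inverse of
      \<open>t\<close>, so \<open>s \<circ> t\<close> agrees with \<open>t'\<close> on the
      diagram.\<close>
    define s where "s m = (if m \<in> {1..k} then t' (cell m) else m)" for m
    have "bij_betw (t' \<circ> cell) {1..k} {1..k}"
      unfolding cell_def
      by (rule bij_betw_trans[OF bij_betw_inv_into[OF bij]]) (use t' in \<open>simp add: is_tableau_def\<close>)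
    moreover have "bij_betw (t' \<circ> cell) {1..k} {1..k} \<longleftrightarrow> bij_betw s {1..k} {1..k}"
      by (rule bij_betw_cong) (simp add: s_def)
    ultimately have "bij_betw s {1..k} {1..k}" by blast
    then have s: "s permutes {1..k}"
      by (rule bij_imp_permutes) (auto simp: s_def)
    have "polytabloid k lam t' = polytabloid k lam (s \<circ> t)"
      by (rule polytabloid_cong) (use t_in in \<open>simp add: s_def\<close>)
    then have "polytabloid k lam t' = specht_act (basis_vec s) pol"
      by (simp only: specht_act_polytabloid[OF s])
    moreover have "filling_tensor (x \<circ> s) \<in> N"
      by (rule filling_tensor_N) (simp only: image_comp[symmetric] permutes_image[OF s] x(2))
    ultimately show ?thesis
      using mod_N0'[OF filling_tensor_compose[OF x(2) s]] by (simp only: x(1))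
  qed
  \<comment> \<open>Membership of \<open>v\<close> is carried along because the additivity relation
    needs it and the induction over the span does not supply it.\<close>
  have step2: "v \<in> ?V \<and> basis_vec (v, polytabloid k lam t') \<in> N"
    if v: "v \<in> ?V" and t': "is_tableau k lam t'" for v t'
    using v unfolding carrier_free_space_eq_span
  proof (induction rule: free.span_induct_alt)
    case base
    have "polytabloid k lam t' \<in> ?S" using t' by (auto simp: carrier_specht intro: free.span_base)
    then show ?case
      using N0[OF relation_space_zero_left[OF kn]] by (simp add: free.span_zero)
  next
    case (step c u v)
    then obtain f where f: "u = basis_vec f" "f \<in> Ltilde_class n k" by blast
    have w: "polytabloid k lam t' \<in> ?S" using t' by (auto simp: carrier_specht intro: free.span_base)
    have u: "u \<in> ?V" using f by (simp add: carrier_free_space)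
    have v: "v \<in> ?V" using step by (simp add: carrier_free_space_eq_span)
    have cu: "cscale c u \<in> ?V" by (rule free.subspace_scale[OF subspace_carrier_free_space u])
    have "basis_vec (u, polytabloid k lam t') \<in> N" using step1 f t' by blast
    then have "basis_vec (cscale c u, polytabloid k lam t') \<in> N"
      using mod_N0[OF relation_space_scale_left[OF kn u w] free.subspace_scale[OF N]] by blast
    moreover have "basis_vec (v, polytabloid k lam t') \<in> N" using step by blast
    ultimately have "basis_vec (cscale c u + v, polytabloid k lam t') \<in> N"
      using mod_N0[OF relation_space_add_left[OF kn cu v w, unfolded diff_diff_eq] free.subspace_add[OF N]]
      by blast
    then show ?case
      using free.subspace_add[OF subspace_carrier_free_space cu v] by (simp only: carrier_free_space_eq_span)
  qed
  have step3: "w \<in> ?S \<and> basis_vec (v, w) \<in> N" if v: "v \<in> ?V" and w: "w \<in> ?S" for v w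
    using w unfolding carrier_specht
  proof (induction rule: free.span_induct_alt)
    case base
    show ?case using N0[OF relation_space_zero_right[OF kn v]] by (simp add: free.span_zero)
  next
    case (step c u w)
    then obtain t' where t': "u = polytabloid k lam t'" "is_tableau k lam t'" by blast
    have u: "u \<in> ?S" unfolding carrier_specht using t' by (intro free.span_base) blast
    have w: "w \<in> ?S" using step by (simp add: carrier_specht)
    have cu: "cscale c u \<in> ?S" by (rule free.subspace_scale[OF subspace_carrier_specht u])
    have "basis_vec (v, u) \<in> N" using step2[OF v t'(2)] t'(1) by blast
    then have "basis_vec (v, cscale c u) \<in> N"
      using mod_N0[OF relation_space_scale_right[OF kn v u] free.subspace_scale[OF N]] by blast
    moreover have "basis_vec (v, w) \<in> N" using step by blast
    ultimately have "basis_vec (v, cscale c u + w) \<in> N"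
      using mod_N0[OF relation_space_add_right[OF kn v cu w, unfolded diff_diff_eq] free.subspace_add[OF N]]
      by blast
    then show ?case
      using free.subspace_add[OF subspace_carrier_specht cu w] by (simp only: carrier_specht)
  qed
  show ?thesis
    unfolding carrier_free_space_eq_span[of "?V \<times> ?S"] N_def[symmetric]
    by (rule free.span_minimal[OF _ N]) (use step3 in auto)
qed

text \<open>The rows of \<open>tabloid_of p\<close> are the images under \<open>p\<close> of the
  rows of \<open>t\<close>, so reading \<open>x\<close> in them is reading
  \<open>x \<circ> p\<close> in the rows of \<open>t\<close>.\<close>

lemma contents_map_filling_tensor:
  "contents_map (filling_tensor x) = (\<Sum>p\<in>columns. cscale (sgn_perm p) (basis_vec (content (x \<circ> p))))"
proof -
  have "row_contents (total_map k x) (tabloid_of p) = content (x \<circ> p)" if p: "p \<in> columns" for p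
  proof -
    have perm: "p permutes {1..k}" by (rule columns_permutes[OF p])
    have "image_mset (\<lambda>m. the (total_map k x m)) (mset_set (p ` row_set i)) = image_mset (x \<circ> p) (mset_set (row_set i))"
      for i
    proof -
      have "image_mset (\<lambda>m. the (total_map k x m)) (mset_set (p ` row_set i)) = image_mset x (mset_set (p ` row_set i))"
      proof (rule image_mset_cong)
        fix m assume "m \<in># mset_set (p ` row_set i)"
        then have "m \<in> p ` row_set i" by (simp add: row_set_def)
        then have "m \<in> p ` {1..k}" by (auto simp: row_set_def)
        then have "m \<in> {1..k}" unfolding permutes_image[OF perm] .
        then show "the (total_map k x m) = x m" by (simp add: total_map_def)
      qed
      also have "\<dots> = image_mset (x \<circ> p) (mset_set (row_set i))"
        using image_mset_mset_set[of p "row_set i"] inj_on_subset[OF permutes_inj[OF perm]]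
        by (metis multiset.map_comp subset_UNIV)
      finally show ?thesis .
    qed
    then show ?thesis by (simp add: row_contents_def tabloid_of_def content_def)
  qed
  then have "lin_ext (\<lambda>T. basis_vec (row_contents (total_map k x) T)) pol
      = (\<Sum>p\<in>columns. cscale (sgn_perm p) (basis_vec (content (x \<circ> p))))"
    unfolding polytabloid_eq lin_ext_sum lin_ext_scale lin_ext_basis
    by (intro sum.cong) simp_all
  then show ?thesis
    by (simp only: filling_tensor_def contents_map_basis contents_form_def lin_ext_basis)
qed

text \<open>Spanning is \<open>pairs_spanned\<close>. For independence, a combination in the
  relation space is sent to zero by \<open>contents_map\<close>, and the leading terms show that its
  coefficients vanish.\<close>

lemma dim_PT_module_tableaux:
  "vectorspace.dim class_ring (PT_module n k lam) = card (semistandard_tableaux lam n)"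
  unfolding PT_module_eq[OF kn]
proof (rule dim_quotient[OF subspace_relation_space[OF kn] relation_space_carrier[OF kn]
      finite_semistandard_tableaux _ pairs_spanned])
  fix T assume "T \<in> semistandard_tableaux lam n"
  then show "filling_tensor (T \<circ> cell) \<in> carrier (free_space (carrier (free_space (Ltilde_class n k)) \<times> carrier (specht k lam)))"
    using total_map_in_carrier[OF semistandard_tableaux_cell(1)] polytabloid_in_specht
    by (simp add: filling_tensor_def carrier_free_space)
next
  fix c T
  assume in_N0: "(\<Sum>T\<in>semistandard_tableaux lam n. cscale (c T) (filling_tensor (T \<circ> cell))) \<in> N0"
    and T: "T \<in> semistandard_tableaux lam n"
  have "(\<Sum>T\<in>semistandard_tableaux lam n. cscale (c T)
      (\<Sum>p\<in>columns. cscale (sgn_perm p) (basis_vec (content (T \<circ> cell \<circ> p))))) = 0"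
    using contents_map_relation_space[OF kn in_N0]
    unfolding contents_map_filling_tensor[symmetric] by (simp only: contents_map_def lin_ext_sum lin_ext_scale)
  moreover have "T1 = T2" if "T1 \<in> semistandard_tableaux lam n" "T2 \<in> semistandard_tableaux lam n"
    "\<And>m. m \<in> {1..k} \<Longrightarrow> (T1 \<circ> cell) m = (T2 \<circ> cell) m" for T1 T2
    using that by (rule semistandard_tableaux_eqI)
  ultimately show "c T = 0"
    using polytabloid_coefficients_independent[of "semistandard_tableaux lam n" "\<lambda>T. T \<circ> cell" c T]
      finite_semistandard_tableaux semistandard_tableaux_cell(2,3) T by blast
qed

end

end

text \<open>Any tableau may be fixed; one exists because the diagram has \<open>k\<close>
  cells.\<close>

lemma dim_PT_module:
  assumes "k \<le> n" "is_partition lam k"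
  shows "vectorspace.dim class_ring (PT_module n k lam) = card (semistandard_tableaux lam n)"
proof -
  have "card (diagram lam) = card {1..k}"
    using assms(2) by (simp add: card_diagram is_partition_def is_composition_def)
  then obtain t where "bij_betw t (diagram lam) {1..k}"
    using finite_same_card_bij[OF finite_diagram finite_atLeastAtMost] by blast
  then have "young_tableau k lam t"
    using assms(2) by (simp add: young_tableau_def is_tableau_def)
  then show ?thesis by (rule young_tableau.dim_PT_module_tableaux[OF _ assms(1)])
qed

subsection \<open>Counting semistandard tableaux\<close>

lemma semistandard_tableaux_relabel:
  assumes T: "T \<in> semistandard_tableaux lam l" and h: "strict_mono_on {1..l} h" "h ` {1..l} \<subseteq> {1..n}"
  shows "restrict (h \<circ> T) (diagram lam) \<in> semistandard_tableaux lam n"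
proof -
  have T_in: "T c \<in> {1..l}" if "c \<in> diagram lam" for c
    using T that unfolding semistandard_tableaux_def by blast
  have "h (T (i, j)) \<le> h (T (i, j'))"
    if ij: "(i, j) \<in> diagram lam" "(i, j') \<in> diagram lam" "j < j'" for i j j'
  proof -
    have "T (i, j) \<le> T (i, j')" using T ij unfolding semistandard_tableaux_def by blast
    then show ?thesis
      using strict_mono_on_leD[OF h(1) T_in[OF ij(1)] T_in[OF ij(2)]] by blast
  qed
  moreover have "h (T (i, j)) < h (T (i', j))"
    if ij: "(i, j) \<in> diagram lam" "(i', j) \<in> diagram lam" "i < i'" for i i' j
  proof -
    have "T (i, j) < T (i', j)" using T ij unfolding semistandard_tableaux_def by blast
    then show ?thesis
      using strict_mono_onD[OF h(1) T_in[OF ij(1)] T_in[OF ij(2)]] by blast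
  qed
  moreover have "h (T c) \<in> {1..n}" if "c \<in> diagram lam" for c
    using h(2) T_in[OF that] by blast
  ultimately show ?thesis by (simp add: semistandard_tableaux_def)
qed

text \<open>Semistandardness depends only on the order of the entries, so relabelling along the
  increasing bijection between \<open>{1..l}\<close> and \<open>A\<close> preserves it in both
  directions.\<close>

lemma card_tableaux_with_entries:
  assumes A: "A \<subseteq> {1..n}" and l: "card A = l"
  shows "card {T \<in> semistandard_tableaux lam n. T ` diagram lam = A}
    = card {T \<in> semistandard_tableaux lam l. T ` diagram lam = {1..l}}" (is "card ?X = card ?Y")
proof -
  have finA: "finite A" using A finite_subset by blast
  obtain h where h: "bij_betw h {..<l} A" "strict_mono_on {..<l} h"
    using ex_bij_betw_strict_mono_card[OF finA] l by metis
  \<comment> \<open>The enumeration \<open>h\<close> of \<open>A\<close> starts at 0, whereas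
    entries of tableaux start at 1.\<close>
  define f where "f i = h (i - 1)" for i
  have pred: "bij_betw (\<lambda>i. i - 1) {1..l} {..<l}"
    by (rule bij_betw_byWitness[of _ Suc]) auto
  have f: "bij_betw f {1..l} A"
    unfolding f_def using bij_betw_trans[OF pred h(1)] by (simp add: comp_def)
  have f_mono: "strict_mono_on {1..l} f"
    unfolding f_def by (rule strict_mono_onI) (use h(2) in \<open>auto intro!: strict_mono_onD[of "{..<l}" h]\<close>)
  define g where "g = inv_into {1..l} f"
  have g: "bij_betw g A {1..l}" unfolding g_def by (rule bij_betw_inv_into[OF f])
  have fg: "f (g a) = a" if "a \<in> A" for a
    unfolding g_def by (rule bij_betw_inv_into_right[OF f that])
  have gf: "g (f i) = i" if "i \<in> {1..l}" for i
    unfolding g_def by (rule bij_betw_inv_into_left[OF f that])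
  have g_le: "g a \<le> g b" if "a \<in> A" "b \<in> A" "a \<le> b" for a b
  proof (rule ccontr)
    assume "\<not> g a \<le> g b"
    then have "f (g b) < f (g a)"
      using bij_betw_apply[OF g] that by (intro strict_mono_onD[OF f_mono]) auto
    then show False using that by (simp add: fg)
  qed
  have g_less: "g a < g b" if "a \<in> A" "b \<in> A" "a < b" for a b
    using g_le[of a b] fg[OF that(1)] fg[OF that(2)] that by (metis le_neq_implies_less less_imp_le less_irrefl)
  have "bij_betw (\<lambda>T. restrict (f \<circ> T) (diagram lam)) ?Y ?X"
  proof (rule bij_betw_byWitness[of _ "\<lambda>T. restrict (g \<circ> T) (diagram lam)"])
    show "\<forall>T\<in>?Y. restrict (g \<circ> restrict (f \<circ> T) (diagram lam)) (diagram lam) = T"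
    proof
      fix T assume T: "T \<in> ?Y"
      show "restrict (g \<circ> restrict (f \<circ> T) (diagram lam)) (diagram lam) = T"
      proof (rule extensionalityI[of _ "diagram lam"])
        show "T \<in> extensional (diagram lam)"
          using T by (auto simp: semistandard_tableaux_def PiE_def)
        fix c assume c: "c \<in> diagram lam"
        then have "T c \<in> {1..l}" using T by blast
        then show "restrict (g \<circ> restrict (f \<circ> T) (diagram lam)) (diagram lam) c = T c"
          using c gf by simp
      qed simp
    qed
    show "\<forall>T\<in>?X. restrict (f \<circ> restrict (g \<circ> T) (diagram lam)) (diagram lam) = T"
    proof
      fix T assume T: "T \<in> ?X"
      show "restrict (f \<circ> restrict (g \<circ> T) (diagram lam)) (diagram lam) = T"
      proof (rule extensionalityI[of _ "diagram lam"])
        show "T \<in> extensional (diagram lam)"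
          using T by (auto simp: semistandard_tableaux_def PiE_def)
        fix c assume c: "c \<in> diagram lam"
        then have "T c \<in> A" using T by blast
        then show "restrict (f \<circ> restrict (g \<circ> T) (diagram lam)) (diagram lam) c = T c"
          using c fg by simp
      qed simp
    qed
    show "(\<lambda>T. restrict (f \<circ> T) (diagram lam)) ` ?Y \<subseteq> ?X"
    proof (intro image_subsetI CollectI conjI)
      fix T assume T: "T \<in> ?Y"
      show "restrict (f \<circ> T) (diagram lam) \<in> semistandard_tableaux lam n"
        using T A bij_betw_imp_surj_on[OF f] by (intro semistandard_tableaux_relabel[OF _ f_mono]) auto
      have "restrict (f \<circ> T) (diagram lam) ` diagram lam = f ` T ` diagram lam" by auto
      also have "\<dots> = A" using T bij_betw_imp_surj_on[OF f] by simp
      finally show "restrict (f \<circ> T) (diagram lam) ` diagram lam = A" .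
    qed
    \<comment> \<open>The domain \<open>A\<close> of \<open>g\<close> need not be an interval, so
      the tableau conditions are checked directly instead of by
      \<open>semistandard_tableaux_relabel\<close>.\<close>
    show "(\<lambda>T. restrict (g \<circ> T) (diagram lam)) ` ?X \<subseteq> ?Y"
    proof (intro image_subsetI CollectI conjI)
      fix T assume T: "T \<in> ?X"
      have T_in: "T c \<in> A" if "c \<in> diagram lam" for c using T that by blast
      have "g (T (i, j)) \<le> g (T (i, j'))"
        if ij: "(i, j) \<in> diagram lam" "(i, j') \<in> diagram lam" "j < j'" for i j j'
        using T ij unfolding semistandard_tableaux_def by (intro g_le T_in) blast+
      moreover have "g (T (i, j)) < g (T (i', j))"
        if ij: "(i, j) \<in> diagram lam" "(i', j) \<in> diagram lam" "i < i'" for i i' j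
        using T ij unfolding semistandard_tableaux_def by (intro g_less T_in) blast+
      moreover have "g (T c) \<in> {1..l}" if "c \<in> diagram lam" for c
        by (rule bij_betw_apply[OF g T_in[OF that]])
      ultimately show "restrict (g \<circ> T) (diagram lam) \<in> semistandard_tableaux lam l"
        by (simp add: semistandard_tableaux_def)
      have "restrict (g \<circ> T) (diagram lam) ` diagram lam = g ` T ` diagram lam" by auto
      also have "\<dots> = {1..l}" using T bij_betw_imp_surj_on[OF g] by simp
      finally show "restrict (g \<circ> T) (diagram lam) ` diagram lam = {1..l}" .
    qed
  qed
  then show ?thesis by (rule bij_betw_same_card[symmetric])
qed

text \<open>All of \<open>1\<close> to \<open>l\<close> occur exactly if every multiplicity is
  positive, that is, if the multiplicities form a composition with \<open>l\<close> parts. The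
  tableaux are thus split by content.\<close>

lemma card_surjective_tableaux:
  assumes lam: "is_partition lam k"
  shows "card {T \<in> semistandard_tableaux lam l. T ` diagram lam = {1..l}}
    = (\<Sum>mu | is_composition mu k \<and> length mu = l. kostka lam mu)"
proof -
  let ?M = "{mu. is_composition mu k \<and> length mu = l}"
  have finM: "finite ?M"
  proof (rule finite_subset)
    show "?M \<subseteq> {mu. set mu \<subseteq> {..k} \<and> length mu = l}"
      by (auto simp: is_composition_def intro: member_le_sum_list)
  qed (simp add: finite_lists_length_eq)
  have SSYT: "SSYT lam mu = {T \<in> semistandard_tableaux lam (length mu).
      \<forall>i<length mu. card {c \<in> diagram lam. T c = Suc i} = mu ! i}" for mu
    by (auto simp only: SSYT_def semistandard_tableaux_def mem_Collect_eq)
  have "{T \<in> semistandard_tableaux lam l. T ` diagram lam = {1..l}} = (\<Union>mu\<in>?M. SSYT lam mu)"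
  proof (intro equalityI subsetI)
    fix T assume "T \<in> {T \<in> semistandard_tableaux lam l. T ` diagram lam = {1..l}}"
    then have T: "T \<in> semistandard_tableaux lam l" "T ` diagram lam = {1..l}" by auto
    define mu where "mu = map (\<lambda>i. card {c \<in> diagram lam. T c = Suc i}) [0..<l]"
    have pos: "card {c \<in> diagram lam. T c = Suc i} > 0" if "i < l" for i
    proof -
      have "Suc i \<in> T ` diagram lam" using T(2) that by simp
      then have "{c \<in> diagram lam. T c = Suc i} \<noteq> {}" by force
      then show ?thesis using finite_diagram[of lam] by (simp add: card_gt_0_iff)
    qed
    have "sum_list mu = (\<Sum>i<l. card {c \<in> diagram lam. T c = Suc i})"
      by (simp add: mu_def sum_list_sum_nth atLeast0LessThan)
    \<comment> \<open>Cells are grouped by \<open>T c - 1\<close>; the truncated subtraction is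
      harmless because entries are at least 1.\<close>
    also have "\<dots> = (\<Sum>i<l. \<Sum>c | c \<in> diagram lam \<and> T c - 1 = i. 1)"
    proof (rule sum.cong)
      fix i assume "i \<in> {..<l}"
      have "{c \<in> diagram lam. T c = Suc i} = {c \<in> diagram lam. T c - 1 = i}"
      proof (intro Collect_cong conj_cong refl)
        fix c assume "c \<in> diagram lam"
        then have "T c \<in> {1..l}" using T(2) by blast
        then show "T c = Suc i \<longleftrightarrow> T c - 1 = i" by auto
      qed
      then show "card {c \<in> diagram lam. T c = Suc i} = (\<Sum>c | c \<in> diagram lam \<and> T c - 1 = i. 1)"
        by simp
    qed simp
    also have "\<dots> = (\<Sum>c\<in>diagram lam. 1)"
    proof (rule sum.group)
      have "T c - 1 < l" if "c \<in> diagram lam" for c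
      proof -
        have "T c \<in> {1..l}" using T(2) that by blast
        then show ?thesis by auto
      qed
      then show "(\<lambda>c. T c - 1) ` diagram lam \<subseteq> {..<l}" by blast
    qed (auto simp: finite_diagram)
    also have "\<dots> = k"
      using lam by (simp add: card_diagram is_partition_def is_composition_def)
    finally have "mu \<in> ?M" using pos by (auto simp: is_composition_def mu_def)
    moreover have "T \<in> SSYT lam mu" using T(1) by (simp add: SSYT mu_def)
    ultimately show "T \<in> (\<Union>mu\<in>?M. SSYT lam mu)" by blast
  next
    fix T assume "T \<in> (\<Union>mu\<in>?M. SSYT lam mu)"
    then obtain mu where mu: "is_composition mu k" "length mu = l" "T \<in> SSYT lam mu" by blast
    then have T: "T \<in> semistandard_tableaux lam l" by (simp add: SSYT)
    have "i \<in> T ` diagram lam" if i: "i \<in> {1..l}" for i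
    proof -
      obtain j where j: "i = Suc j" "j < length mu"
        using i mu(2) by (cases i) auto
      then have "card {c \<in> diagram lam. T c = i} = mu ! j"
        using mu(3) by (simp add: SSYT)
      moreover have "mu ! j > 0"
        using mu(1) j(2) by (simp add: is_composition_def)
      ultimately have "{c \<in> diagram lam. T c = i} \<noteq> {}" by (metis card.empty less_irrefl)
      then show ?thesis by auto
    qed
    moreover have "T ` diagram lam \<subseteq> {1..l}"
      using T unfolding semistandard_tableaux_def by blast
    ultimately show "T \<in> {T \<in> semistandard_tableaux lam l. T ` diagram lam = {1..l}}"
      using T by blast
  qed
  also have "card \<dots> = (\<Sum>mu\<in>?M. card (SSYT lam mu))"
  proof (rule card_UN_disjoint[OF finM])
    show "\<forall>mu\<in>?M. finite (SSYT lam mu)"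
      by (simp add: SSYT finite_semistandard_tableaux)
    show "\<forall>mu\<in>?M. \<forall>nu\<in>?M. mu \<noteq> nu \<longrightarrow> SSYT lam mu \<inter> SSYT lam nu = {}"
    proof (intro ballI impI, rule ccontr)
      fix mu nu assume m: "mu \<in> ?M" "nu \<in> ?M" "mu \<noteq> nu" "SSYT lam mu \<inter> SSYT lam nu \<noteq> {}"
      then obtain T where T: "T \<in> SSYT lam mu" "T \<in> SSYT lam nu" by blast
      have "mu = nu"
      proof (rule nth_equalityI)
        show "length mu = length nu" using m by simp
        show "mu ! i = nu ! i" if "i < length mu" for i
          using T m that by (simp add: SSYT)
      qed
      then show False using m by simp
    qed
  qed
  finally show ?thesis by (simp add: kostka_def)
qed

text \<open>The number of tableaux with a given set of entries depends only on its size
  \<open>l\<close>, and there are \<open>n choose l\<close> such sets.\<close>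

lemma card_semistandard_tableaux:
  assumes "k \<le> n" "is_partition lam k"
  shows "card (semistandard_tableaux lam n)
    = (\<Sum>l=0..k. (n choose l) * (\<Sum>mu | is_composition mu k \<and> length mu = l. kostka lam mu))"
proof -
  let ?S = "semistandard_tableaux lam"
  let ?g = "\<lambda>l. card {T \<in> ?S l. T ` diagram lam = {1..l}}"
  have "card (?S n) = (\<Sum>A\<in>Pow {1..n}. \<Sum>T | T \<in> ?S n \<and> T ` diagram lam = A. 1)"
  proof (subst sum.group)
    show "(\<lambda>T. T ` diagram lam) ` ?S n \<subseteq> Pow {1..n}"
      unfolding semistandard_tableaux_def by blast
  qed (auto simp: finite_semistandard_tableaux)
  also have "\<dots> = (\<Sum>A\<in>Pow {1..n}. ?g (card A))"
  proof (rule sum.cong)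
    fix A assume "A \<in> Pow {1..n}"
    then show "(\<Sum>T | T \<in> ?S n \<and> T ` diagram lam = A. 1) = ?g (card A)"
      using card_tableaux_with_entries[of A n "card A" lam] by simp
  qed simp
  also have "\<dots> = (\<Sum>l\<in>{0..n}. \<Sum>A | A \<in> Pow {1..n} \<and> card A = l. ?g (card A))"
  proof (rule sum.group[symmetric])
    show "card ` Pow {1..n} \<subseteq> {0..n}"
      using card_mono[of "{1..n}"] by auto
  qed auto
  also have "\<dots> = (\<Sum>l\<in>{0..n}. (n choose l) * ?g l)"
  proof (rule sum.cong)
    fix l
    have "(\<Sum>A | A \<in> Pow {1..n} \<and> card A = l. ?g (card A)) = (\<Sum>A | A \<subseteq> {1..n} \<and> card A = l. ?g l)"
      by (rule sum.cong) auto
    then show "(\<Sum>A | A \<in> Pow {1..n} \<and> card A = l. ?g (card A)) = (n choose l) * ?g l"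
      by (simp add: n_subsets)
  qed simp
  \<comment> \<open>A tableau with \<open>k\<close> cells shows at most \<open>k\<close> different
    entries, so the terms with \<open>l > k\<close> vanish.\<close>
  also have "\<dots> = (\<Sum>l\<in>{0..k}. (n choose l) * ?g l)"
  proof (rule sum.mono_neutral_right)
    show "\<forall>l\<in>{0..n} - {0..k}. (n choose l) * ?g l = 0"
    proof
      fix l assume l: "l \<in> {0..n} - {0..k}"
      have "T ` diagram lam \<noteq> {1..l}" for T :: "nat \<times> nat \<Rightarrow> nat"
      proof
        assume "T ` diagram lam = {1..l}"
        then have "l \<le> card (diagram lam)"
          using card_image_le[OF finite_diagram, of T lam] by simp
        then show False
          using l assms(2) by (simp add: card_diagram is_partition_def is_composition_def)
      qed
      then show "(n choose l) * ?g l = 0" by simp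
    qed
  qed (use assms(1) in auto)
  finally show ?thesis by (simp only: card_surjective_tableaux[OF assms(2)])
qed

theorem proposition7p2:
  fixes n k :: nat and lam :: "nat list"
  assumes "k \<le> n" and "is_partition lam k"
  shows "vectorspace.dim class_ring (PT_module n k lam) =
    (\<Sum>l=0..k. \<Sum>mu | is_composition mu k \<and> length mu = l. (n choose l) * kostka lam mu)"
  by (simp only: dim_PT_module[OF assms] card_semistandard_tableaux[OF assms] sum_distrib_left)

end
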